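(* Let $\Omega$ be a nonempty finite set, and for each subgroup $G\leq\operatorname{Sym}(\Omega)$ let $\mu(G)$ be the set of orbital graphs of $G$. The set of 2-closed subgroups of $\operatorname{Sym}(\Omega)$ is closed under conjugation by $\operatorname{Sym}(\Omega)$, and the restriction of $\mu$ to this set is injective and $\operatorname{Sym}(\Omega)$-invariant. Consequently, for all 2-closed subgroups $G,H\leq\operatorname{Sym}(\Omega)$, $$\{x\in\operatorname{Sym}(\Omega): x^{-1}Gx=H\}=\operatorname{Transp}(\mu(G),\mu(H)),$$ and the pair of constant functions on $\operatorname{Stacks}(\mathcal{O})$ with images the one-entry stacks $[\psi(\mu(G))]$ and $[\psi(\mu(H))]$, where $\mathcal{O}$ is the set of all extended graphs on $\Omega$, is a perfect refiner for $\{x\in\operatorname{Sym}(\Omega): x^{-1}Gx=H\}$. In particular (with $H=G$) this gives a perfect refiner in extended graph backtracking for the normaliser of $G$ in $\operatorname{Sym}(\Omega)$.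
   Context: Actions are right actions, written by exponentiation. A digraph on a set $V$ is a pair $(V,A)$ with arc set $A \subseteq V\times V$ (loops allowed); a labelled digraph additionally has a label assigned to each vertex and each arc. $\operatorname{Sym}(V)$ acts on (labelled) digraphs on $V$ by renaming vertices (carrying labels along). Any action of $\operatorname{Sym}(\Omega)$ on a set induces actions elementwise on its subsets and entrywise on finite lists of its elements. A function $f:X\to Y$ between sets on which $\operatorname{Sym}(\Omega)$ acts is $\operatorname{Sym}(\Omega)$-invariant if $f(x^g)=f(x)^g$ for all $x\in X$, $g\in\operatorname{Sym}(\Omega)$; on subgroups the action is conjugation $G^g=g^{-1}Gg$. The orbital graph of $G\leq\operatorname{Sym}(\Omega)$ with base-pair $(\alpha,\beta)\in\Omega\times\Omega$ (where $\alpha=\beta$ is allowed) is the digraph $(\Omega,\{(\alpha^g,\beta^g):g\in G\})$. The 2-closure of $G$ is the largest subgroup of $\operatorname{Sym}(\Omega)$ with the same orbits on $\Omega\times\Omega$ as $G$; $G$ is 2-closed if it equals its 2-closure. Fix an infinite well-ordered set $\Lambda\supseteq\Omega$ with $\alpha<\beta$ for all $\alpha\in\Omega$, $\beta\in\Lambda\setminus\Omega$. For $\Omega\subseteq V\subseteq\Lambda$, regard $\operatorname{Sym}(\Omega)$ and $\operatorname{Sym}(V\setminus\Omega)$ as (commuting) subgroups of $\operatorname{Sym}(V)$. An extended graph on $\Omega$ is an orbit $\overline{\Gamma}$ of $\operatorname{Sym}(V\setminus\Omega)$ on the set of labelled digraphs on $V$, for some finite $V$ with $\Omega\subseteq V\subseteq\Lambda$.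 $\operatorname{Sym}(\Omega)$ acts by $(\overline{\Gamma})^g=\overline{\Gamma^g}$. The function $\psi$ maps finite sets of digraphs on $\Omega$ to extended graphs on $\Omega$ as follows. Fix three distinct labels $x_0$, $\#$, $\circledast$. Given $A=\{\Gamma_1,\dots,\Gamma_k\}$ (indexed arbitrarily), partition the least $k|\Omega|$ elements of $\Lambda\setminus\Omega$ into parts $V_1,\dots,V_k$ of size $|\Omega|$, choose bijections $\tau_i:\Omega\to V_i$, and let $X=\{x_1,\dots,x_k\}$ be the next $k$ least elements of $\Lambda$. Then $\psi(A)$ is the extended graph containing the labelled digraph on $\Omega\cup V_1\cup\dots\cup V_k\cup X$ whose arcs are, for each $i$: $(\tau_i(\alpha),\alpha)$ and $(\tau_i(\alpha),x_i)$ for all $\alpha\in\Omega$, and $(\tau_i(\alpha),\tau_i(\beta))$ for each arc $(\alpha,\beta)$ of $\Gamma_i$; vertices in $\Omega$ and arcs ending in $\Omega$ have label $\#$, vertices in $X$ and arcs ending in $X$ have label $\circledast$, and all other vertices and arcs have label $x_0$. (The result does not depend on the choices.) For a set $\mathcal{O}$ on which $\operatorname{Sym}(\Omega)$ acts, $\operatorname{Stacks}(\mathcal{O})$ is the set of all finite lists (including the empty one) with entries in $\mathcal{O}$; $|S|$ is length and $\Vert$ is concatenation. $\operatorname{Transp}(x,y) = \{g\in\operatorname{Sym}(\Omega) : x^g=y\}$. A refiner for $U\subseteq\operatorname{Sym}(\Omega)$ (with respect to $\mathcal{O}$) is a pair $(f_L,f_R)$ of functions from $\operatorname{Stacks}(\mathcal{O})$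 to itself such that $U\cap\operatorname{Transp}(S,T)\subseteq\operatorname{Transp}(f_L(S),f_R(T))$ for all $S,T$. It is perfect if $U\cap\operatorname{Transp}(S,T)=\operatorname{Transp}(S\Vert f_L(S),\,T\Vert f_R(T))$ for all $S,T$ with $|S|=|T|$. Extended graph backtracking is the case where $\mathcal{O}$ is the set of all extended graphs on $\Omega$. *)

theory Defs
  imports
    "Graph_Theory.Pair_Digraph"
    "HOL-Algebra.Group_Action"
    "HOL-Combinatorics.Permutations"
    "HOL-Library.Disjoint_Sets"
    "HOL-Library.Infinite_Set"
    "HOL-Library.FuncSet"
begin

text \<open>
  Actions are right actions: the image \<open>\<alpha>^g\<close> is \<open>g \<alpha>\<close>, and the product \<open>g h\<close> means
  first \<open>g\<close>, then \<open>h\<close>. A permutation of \<open>\<Omega>\<close> fixes everything outside \<open>\<Omega>\<close>, so for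
  \<open>\<Omega> \<subseteq> V\<close> both \<open>Sym \<Omega>\<close> and \<open>Sym (V - \<Omega>)\<close> are literally subgroups of \<open>Sym V\<close>.
  The library constants \<open>orbit\<close> and \<open>orbits\<close> depend on the carrier of the group and the
  action map only, so they apply to right actions too (whereas the locale
  \<open>group_action\<close> is about left actions).
\<close>

definition Sym :: "'a set \<Rightarrow> ('a \<Rightarrow> 'a) monoid" where
  "Sym \<Omega> = \<lparr>carrier = {p. p permutes \<Omega>}, mult = (\<lambda>g h. h \<circ> g), one = id\<rparr>"

definition conjugate :: "'a set \<Rightarrow> ('a \<Rightarrow> 'a) \<Rightarrow> ('a \<Rightarrow> 'a) set \<Rightarrow> ('a \<Rightarrow> 'a) set" where
  "conjugate \<Omega> g G = inv\<^bsub>Sym \<Omega>\<^esub> g <#\<^bsub>Sym \<Omega>\<^esub> G #>\<^bsub>Sym \<Omega>\<^esub> g"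

definition orbitals :: "'a set \<Rightarrow> ('a \<Rightarrow> 'a) set \<Rightarrow> ('a \<times> 'a) set set" where
  "orbitals \<Omega> G = Group_Action.orbits (Sym \<Omega>\<lparr>carrier := G\<rparr>) (\<Omega> \<times> \<Omega>) (\<lambda>g. map_prod g g)"

definition two_closure :: "'a set \<Rightarrow> ('a \<Rightarrow> 'a) set \<Rightarrow> ('a \<Rightarrow> 'a) set" where
  "two_closure \<Omega> G = (GREATEST K. subgroup K (Sym \<Omega>) \<and> orbitals \<Omega> K = orbitals \<Omega> G)"

definition two_closed_subgroups :: "'a set \<Rightarrow> ('a \<Rightarrow> 'a) set set" where
  "two_closed_subgroups \<Omega> = {G. subgroup G (Sym \<Omega>) \<and> two_closure \<Omega> G = G}"

text \<open>An action of \<open>Sym \<Omega>\<close> is given by the map \<open>act\<close>, with \<open>x^g = act g x\<close>.\<close>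

definition Transp :: "'a set \<Rightarrow> (('a \<Rightarrow> 'a) \<Rightarrow> 'x \<Rightarrow> 'x) \<Rightarrow> 'x \<Rightarrow> 'x \<Rightarrow> ('a \<Rightarrow> 'a) set" where
  "Transp \<Omega> act x y = {g \<in> carrier (Sym \<Omega>). act g x = y}"

definition Sym_invariant_on ::
  "'a set \<Rightarrow> (('a \<Rightarrow> 'a) \<Rightarrow> 'x \<Rightarrow> 'x) \<Rightarrow> (('a \<Rightarrow> 'a) \<Rightarrow> 'y \<Rightarrow> 'y) \<Rightarrow> 'x set \<Rightarrow> ('x \<Rightarrow> 'y) \<Rightarrow> bool" where
  "Sym_invariant_on \<Omega> actX actY X f \<longleftrightarrow>
     (\<forall>x\<in>X. \<forall>g\<in>carrier (Sym \<Omega>). f (actX g x) = actY g (f x))"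

definition digraphs_on :: "'a set \<Rightarrow> 'a pair_pre_digraph set" where
  "digraphs_on V = {\<Gamma>. pair_wf_digraph \<Gamma> \<and> pverts \<Gamma> = V}"

definition rename_digraph :: "('a \<Rightarrow> 'a) \<Rightarrow> 'a pair_pre_digraph \<Rightarrow> 'a pair_pre_digraph" where
  "rename_digraph g \<Gamma> = \<lparr>pverts = g ` pverts \<Gamma>, parcs = map_prod g g ` parcs \<Gamma>\<rparr>"

definition orbital_graph :: "'a set \<Rightarrow> ('a \<Rightarrow> 'a) set \<Rightarrow> 'a \<Rightarrow> 'a \<Rightarrow> 'a pair_pre_digraph" where
  "orbital_graph \<Omega> G \<alpha> \<beta> = \<lparr>pverts = \<Omega>, parcs = {(g \<alpha>, g \<beta>) | g. g \<in> G}\<rparr>"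

definition orbital_graphs :: "'a set \<Rightarrow> ('a \<Rightarrow> 'a) set \<Rightarrow> 'a pair_pre_digraph set" where
  "orbital_graphs \<Omega> G = {orbital_graph \<Omega> G \<alpha> \<beta> | \<alpha> \<beta>. \<alpha> \<in> \<Omega> \<and> \<beta> \<in> \<Omega>}"

text \<open>
  Labellings are partial maps defined exactly on the vertices (arcs), so that equality of
  the records is equality of labelled digraphs.
\<close>

record ('a, 'l) labelled_digraph =
  digraph :: "'a pair_pre_digraph"
  vlabel :: "'a \<rightharpoonup> 'l"
  alabel :: "'a \<times> 'a \<rightharpoonup> 'l"

definition labelled_digraphs_on :: "'a set \<Rightarrow> ('a, 'l) labelled_digraph set" where
  "labelled_digraphs_on V =
     {\<Gamma>. digraph \<Gamma> \<in> digraphs_on V \<and> dom (vlabel \<Gamma>) = V \<and> dom (alabel \<Gamma>) = parcs (digraph \<Gamma>)}"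

definition rename_labelled ::
  "('a \<Rightarrow> 'a) \<Rightarrow> ('a, 'l) labelled_digraph \<Rightarrow> ('a, 'l) labelled_digraph" where
  "rename_labelled g \<Gamma> =
     \<lparr>digraph = rename_digraph g (digraph \<Gamma>),
      vlabel = vlabel \<Gamma> \<circ> inv_into UNIV g,
      alabel = alabel \<Gamma> \<circ> map_prod (inv_into UNIV g) (inv_into UNIV g)\<rparr>"

definition extended_graphs :: "'a set \<Rightarrow> 'a set \<Rightarrow> ('a, 'l) labelled_digraph set set" where
  "extended_graphs \<Lambda> \<Omega> =
     (\<Union>V\<in>{V. finite V \<and> \<Omega> \<subseteq> V \<and> V \<subseteq> \<Lambda>}.
        Group_Action.orbits (Sym (V - \<Omega>)) (labelled_digraphs_on V) rename_labelled)"

text \<open>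
  Since \<open>Sym \<Omega>\<close> commutes with \<open>Sym (V - \<Omega>)\<close>, the image under \<open>g\<close> of the orbit of \<open>\<Gamma>\<close>
  is the orbit of \<open>\<Gamma>^g\<close>.
\<close>

definition rename_extended ::
  "('a \<Rightarrow> 'a) \<Rightarrow> ('a, 'l) labelled_digraph set \<Rightarrow> ('a, 'l) labelled_digraph set" where
  "rename_extended g E = rename_labelled g ` E"

text \<open>
  For infinite \<open>S\<close>, the elements of \<open>S\<close> in increasing order start with
  \<open>enumerate S 0, enumerate S 1, \<dots>\<close>. Indices run over \<open>{..<k}\<close> instead of \<open>{1..k}\<close>.
\<close>

definition psi_choice ::
  "'a::wellorder set \<Rightarrow> 'a set \<Rightarrow> 'a pair_pre_digraph set \<Rightarrow>
   (nat \<Rightarrow> 'a pair_pre_digraph) \<Rightarrow> (nat \<Rightarrow> 'a set) \<Rightarrow> (nat \<Rightarrow> 'a \<Rightarrow> 'a) \<Rightarrow> (nat \<Rightarrow> 'a) \<Rightarrow> bool" where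
  "psi_choice \<Lambda> \<Omega> A \<Gamma> V \<tau> x \<longleftrightarrow>
     (let k = card A; m = k * card \<Omega> in
        bij_betw \<Gamma> {..<k} A \<and>
        disjoint_family_on V {..<k} \<and>
        (\<Union>i<k. V i) = enumerate (\<Lambda> - \<Omega>) ` {..<m} \<and>
        (\<forall>i<k. bij_betw (\<tau> i) \<Omega> (V i)) \<and>
        bij_betw x {..<k} (enumerate (\<Lambda> - \<Omega>) ` {m..<m + k}))"

definition psi_digraph ::
  "'a set \<Rightarrow> nat \<Rightarrow> (nat \<Rightarrow> 'a pair_pre_digraph) \<Rightarrow> (nat \<Rightarrow> 'a \<Rightarrow> 'a) \<Rightarrow> (nat \<Rightarrow> 'a) \<Rightarrow>
   'a pair_pre_digraph" where
  "psi_digraph \<Omega> k \<Gamma> \<tau> x =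
     \<lparr>pverts = \<Omega> \<union> (\<Union>i<k. \<tau> i ` \<Omega>) \<union> x ` {..<k},
      parcs = (\<Union>i<k. {(\<tau> i \<alpha>, \<alpha>) | \<alpha>. \<alpha> \<in> \<Omega>} \<union> {(\<tau> i \<alpha>, x i) | \<alpha>. \<alpha> \<in> \<Omega>}
                       \<union> {(\<tau> i \<alpha>, \<tau> i \<beta>) | \<alpha> \<beta>. (\<alpha>, \<beta>) \<in> parcs (\<Gamma> i)})\<rparr>"

definition psi_label :: "'l \<Rightarrow> 'l \<Rightarrow> 'l \<Rightarrow> 'a set \<Rightarrow> 'a set \<Rightarrow> 'a \<Rightarrow> 'l" where
  "psi_label lab0 lab_hash lab_ast \<Omega> X v =
     (if v \<in> \<Omega> then lab_hash else if v \<in> X then lab_ast else lab0)"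

text \<open>The label of an arc is determined by its end vertex, by the same rule as for vertices.\<close>

definition psi_labelled_digraph ::
  "'l \<Rightarrow> 'l \<Rightarrow> 'l \<Rightarrow> 'a set \<Rightarrow> nat \<Rightarrow> (nat \<Rightarrow> 'a pair_pre_digraph) \<Rightarrow> (nat \<Rightarrow> 'a \<Rightarrow> 'a) \<Rightarrow>
   (nat \<Rightarrow> 'a) \<Rightarrow> ('a, 'l) labelled_digraph" where
  "psi_labelled_digraph lab0 lab_hash lab_ast \<Omega> k \<Gamma> \<tau> x =
     (let \<Delta> = psi_digraph \<Omega> k \<Gamma> \<tau> x;
          lab = psi_label lab0 lab_hash lab_ast \<Omega> (x ` {..<k})
      in \<lparr>digraph = \<Delta>,
          vlabel = (\<lambda>v. if v \<in> pverts \<Delta> then Some (lab v) else None),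
          alabel = (\<lambda>e. if e \<in> parcs \<Delta> then Some (lab (snd e)) else None)\<rparr>)"

definition psi ::
  "'l \<Rightarrow> 'l \<Rightarrow> 'l \<Rightarrow> 'a::wellorder set \<Rightarrow> 'a set \<Rightarrow> 'a pair_pre_digraph set \<Rightarrow>
   ('a, 'l) labelled_digraph set" where
  "psi lab0 lab_hash lab_ast \<Lambda> \<Omega> A =
     (THE E. E \<in> extended_graphs \<Lambda> \<Omega> \<and>
        (\<exists>\<Gamma> V \<tau> x. psi_choice \<Lambda> \<Omega> A \<Gamma> V \<tau> x \<and>
           psi_labelled_digraph lab0 lab_hash lab_ast \<Omega> (card A) \<Gamma> \<tau> x \<in> E))"

abbreviation Stacks :: "'o set \<Rightarrow> 'o list set" where
  "Stacks \<O> \<equiv> lists \<O>"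

definition rename_stack ::
  "(('a \<Rightarrow> 'a) \<Rightarrow> 'o \<Rightarrow> 'o) \<Rightarrow> ('a \<Rightarrow> 'a) \<Rightarrow> 'o list \<Rightarrow> 'o list" where
  "rename_stack act g S = map (act g) S"

definition refiner ::
  "'a set \<Rightarrow> (('a \<Rightarrow> 'a) \<Rightarrow> 'o \<Rightarrow> 'o) \<Rightarrow> 'o set \<Rightarrow> ('a \<Rightarrow> 'a) set \<Rightarrow>
   ('o list \<Rightarrow> 'o list) \<Rightarrow> ('o list \<Rightarrow> 'o list) \<Rightarrow> bool" where
  "refiner \<Omega> act \<O> U fL fR \<longleftrightarrow>
     U \<subseteq> carrier (Sym \<Omega>) \<and>
     fL \<in> Stacks \<O> \<rightarrow> Stacks \<O> \<and> fR \<in> Stacks \<O> \<rightarrow> Stacks \<O> \<and>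
     (\<forall>S\<in>Stacks \<O>. \<forall>T\<in>Stacks \<O>.
        U \<inter> Transp \<Omega> (rename_stack act) S T \<subseteq> Transp \<Omega> (rename_stack act) (fL S) (fR T))"

definition perfect_refiner ::
  "'a set \<Rightarrow> (('a \<Rightarrow> 'a) \<Rightarrow> 'o \<Rightarrow> 'o) \<Rightarrow> 'o set \<Rightarrow> ('a \<Rightarrow> 'a) set \<Rightarrow>
   ('o list \<Rightarrow> 'o list) \<Rightarrow> ('o list \<Rightarrow> 'o list) \<Rightarrow> bool" where
  "perfect_refiner \<Omega> act \<O> U fL fR \<longleftrightarrow>
     refiner \<Omega> act \<O> U fL fR \<and>
     (\<forall>S\<in>Stacks \<O>. \<forall>T\<in>Stacks \<O>. length S = length T \<longrightarrow>
        U \<inter> Transp \<Omega> (rename_stack act) S T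
          = Transp \<Omega> (rename_stack act) (S @ fL S) (T @ fR T))"

end

theory Submission
  imports Defs
begin

text \<open>
  The orbital graphs of \<open>G\<close> are its orbitals with vertex set \<open>\<Omega>\<close>, so \<open>\<mu>(G)\<close> determines the
  2-closure of \<open>G\<close>; and renaming by \<open>x\<close> maps the orbitals of \<open>G\<close> to those of \<open>x\<inverse>Gx\<close>.

  For \<open>\<psi>\<close>, the point is that \<open>\<psi>(A)^g = \<psi>(B)\<close> iff \<open>A^g = B\<close>. If \<open>A^g = B\<close>, then \<open>g\<close> together
  with the induced bijection of indices extends to an isomorphism of any two of the labelled
  digraphs chosen for \<open>A\<close> and \<open>B\<close>; the case \<open>g = 1\<close> is independence of the choices.
  Conversely, an isomorphism extending \<open>g\<close> respects the labels and hence the gadgets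
  \<open>(V\<^sub>i, x\<^sub>i)\<close>, and the arcs from \<open>V\<^sub>i\<close> to \<open>\<Omega>\<close> force it to act on each copy of a digraph as \<open>g\<close>.
\<close>

section \<open>Permutation groups and their orbital graphs\<close>

lemma Sym_simps [simp]:
  "carrier (Sym \<Omega>) = {p. p permutes \<Omega>}"
  "g \<otimes>\<^bsub>Sym \<Omega>\<^esub> h = h \<circ> g"
  "\<one>\<^bsub>Sym \<Omega>\<^esub> = id"
  by (simp_all add: Sym_def)

lemma group_Sym: "group (Sym \<Omega>)"
  by (rule groupI)
    (auto simp: permutes_compose permutes_id comp_assoc intro: permutes_inv permutes_inv_o)

lemma m_inv_Sym [simp]:
  assumes "g permutes \<Omega>"
  shows "inv\<^bsub>Sym \<Omega>\<^esub> g = inv_into UNIV g"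
  by (rule group.inv_equality[OF group_Sym])
    (use assms in \<open>auto simp: permutes_inv permutes_inv_o\<close>)

lemma subgroup_Sym_iff:
  "subgroup G (Sym \<Omega>) \<longleftrightarrow>
     G \<subseteq> {p. p permutes \<Omega>} \<and> id \<in> G \<and>
     (\<forall>g\<in>G. \<forall>h\<in>G. h \<circ> g \<in> G) \<and> (\<forall>g\<in>G. inv_into UNIV g \<in> G)"
proof
  assume G: "subgroup G (Sym \<Omega>)"
  then have perm: "\<And>g. g \<in> G \<Longrightarrow> g permutes \<Omega>"
    using subgroup.subset by fastforce
  then show "G \<subseteq> {p. p permutes \<Omega>} \<and> id \<in> G \<and>
      (\<forall>g\<in>G. \<forall>h\<in>G. h \<circ> g \<in> G) \<and> (\<forall>g\<in>G. inv_into UNIV g \<in> G)"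
    using subgroup.m_closed[OF G] subgroup.one_closed[OF G] subgroup.m_inv_closed[OF G] by auto
next
  assume "G \<subseteq> {p. p permutes \<Omega>} \<and> id \<in> G \<and>
      (\<forall>g\<in>G. \<forall>h\<in>G. h \<circ> g \<in> G) \<and> (\<forall>g\<in>G. inv_into UNIV g \<in> G)"
  then show "subgroup G (Sym \<Omega>)"
    by (intro subgroup.intro) (auto simp: subset_iff)
qed

section \<open>Conjugation of subgroups\<close>

text \<open>Products in \<open>Sym\<close> compose from left to right, so x^{-1} g x is the function
  \<open>x \<circ> g \<circ> inv_into UNIV x\<close>.\<close>

lemma conjugate_eq:
  assumes "x permutes \<Omega>"
  shows "conjugate \<Omega> x G = (\<lambda>g. x \<circ> g \<circ> inv_into UNIV x) ` G"
  using assms by (auto simp: conjugate_def l_coset_def r_coset_def comp_assoc)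

lemma conjugate_inv_conjugate:
  assumes "x permutes \<Omega>"
  shows "conjugate \<Omega> (inv_into UNIV x) (conjugate \<Omega> x G) = G"
proof -
  have "inv_into UNIV x \<circ> (x \<circ> g \<circ> inv_into UNIV x) \<circ> inv_into UNIV (inv_into UNIV x) = g" for g
    using permutes_inverses[OF assms] permutes_inv_inv[OF assms] by (simp add: fun_eq_iff)
  then show ?thesis
    using assms permutes_inv[OF assms] by (simp add: conjugate_eq image_image)
qed

lemma conjugate_conjugate_inv:
  assumes "x permutes \<Omega>"
  shows "conjugate \<Omega> x (conjugate \<Omega> (inv_into UNIV x) G) = G"
  using conjugate_inv_conjugate[OF permutes_inv[OF assms]] permutes_inv_inv[OF assms] by simp

lemma conjugate_mono:
  assumes "x permutes \<Omega>" and "G \<subseteq> H"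
  shows "conjugate \<Omega> x G \<subseteq> conjugate \<Omega> x H"
  using assms by (auto simp: conjugate_eq)

lemma subgroup_conjugate:
  assumes x: "x permutes \<Omega>" and G: "subgroup G (Sym \<Omega>)"
  shows "subgroup (conjugate \<Omega> x G) (Sym \<Omega>)"
proof -
  let ?c = "\<lambda>g. x \<circ> g \<circ> inv_into UNIV x"
  have perm: "g permutes \<Omega>" if "g \<in> G" for g
    using that G by (auto simp: subgroup_Sym_iff)
  have c_perm: "?c g permutes \<Omega>" if "g \<in> G" for g
    using perm[OF that] x by (intro permutes_compose permutes_inv)
  have c_id: "?c id = id"
    using permutes_inv_o[OF x] by simp
  have c_comp: "?c h \<circ> ?c g = ?c (h \<circ> g)" for g h
    using permutes_inverses[OF x] by (simp add: fun_eq_iff)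
  have c_inv: "inv_into UNIV (?c g) = ?c (inv_into UNIV g)" if "g \<in> G" for g
    using permutes_inverses[OF x] permutes_inverses[OF perm[OF that]]
    by (intro inv_unique_comp) (simp_all add: fun_eq_iff)
  show ?thesis
    unfolding subgroup_Sym_iff conjugate_eq[OF x]
  proof (intro conjI ballI; (elim imageE)?)
    show "?c ` G \<subseteq> {p. p permutes \<Omega>}"
      using c_perm by blast
    show "id \<in> ?c ` G"
      using G c_id unfolding subgroup_Sym_iff by (metis imageI)
    show "h' \<circ> g' \<in> ?c ` G" if "g \<in> G" "h \<in> G" "g' = ?c g" "h' = ?c h" for g h g' h'
      unfolding that(3,4) c_comp using that(1,2) G unfolding subgroup_Sym_iff by blast
    show "inv_into UNIV g' \<in> ?c ` G" if "g \<in> G" "g' = ?c g" for g g'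
      unfolding that(2) c_inv[OF that(1)] using that(1) G unfolding subgroup_Sym_iff by blast
  qed
qed

section \<open>Orbitals and orbital graphs\<close>

lemma orbitals_eq:
  "orbitals \<Omega> G = (\<lambda>(\<alpha>, \<beta>). (\<lambda>g. (g \<alpha>, g \<beta>)) ` G) ` (\<Omega> \<times> \<Omega>)"
  unfolding orbitals_def Group_Action.orbits_def Group_Action.orbit_def Setcompr_eq_image
  by (rule image_cong) (simp_all add: case_prod_unfold map_prod_def)

lemma orbital_graphs_eq:
  "orbital_graphs \<Omega> G = (\<lambda>A. \<lparr>pverts = \<Omega>, parcs = A\<rparr>) ` orbitals \<Omega> G"
  unfolding orbital_graphs_def orbital_graph_def orbitals_eq Setcompr_eq_image image_image
  by (auto simp: image_iff)

lemma orbital_graphs_eq_iff: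
  "orbital_graphs \<Omega> G = orbital_graphs \<Omega> H \<longleftrightarrow> orbitals \<Omega> G = orbitals \<Omega> H"
  unfolding orbital_graphs_eq by (rule inj_image_eq_iff) (simp add: inj_on_def)

lemma finite_orbital_graphs:
  assumes "finite \<Omega>"
  shows "finite (orbital_graphs \<Omega> G)"
proof -
  have "orbital_graphs \<Omega> G = (\<lambda>(\<alpha>, \<beta>). orbital_graph \<Omega> G \<alpha> \<beta>) ` (\<Omega> \<times> \<Omega>)"
    by (auto simp: orbital_graphs_def)
  then show ?thesis
    using assms by simp
qed

lemma orbital_graphs_digraphs_on:
  assumes "subgroup G (Sym \<Omega>)"
  shows "orbital_graphs \<Omega> G \<subseteq> digraphs_on \<Omega>"
proof -
  have "g \<alpha> \<in> \<Omega>" if "g \<in> G" "\<alpha> \<in> \<Omega>" for g \<alpha>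
    using assms that by (auto simp: subgroup_Sym_iff permutes_in_image)
  then show ?thesis
    by (auto simp: orbital_graphs_def orbital_graph_def digraphs_on_def pair_wf_digraph_def)
qed

text \<open>The arc \<open>(g \<alpha>, g \<beta>)\<close> goes to
  \<open>(h (x \<alpha>), h (x \<beta>))\<close> for
  \<open>h = x \<circ> g \<circ> inv_into UNIV x\<close>, as the inverse of \<open>x\<close>
  cancels.\<close>

lemma rename_orbital_graph:
  assumes "x permutes \<Omega>"
  shows "rename_digraph x (orbital_graph \<Omega> G \<alpha> \<beta>)
    = orbital_graph \<Omega> (conjugate \<Omega> x G) (x \<alpha>) (x \<beta>)"
  using assms
  by (simp add: rename_digraph_def orbital_graph_def conjugate_eq permutes_image permutes_inverses
      Setcompr_eq_image image_image)

text \<open>Renaming moves the base-pair by \<open>x\<close>; as \<open>x\<close> permutes \<Omega>,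
  both sides run over all base-pairs.\<close>

lemma orbital_graphs_conjugate:
  assumes "x permutes \<Omega>"
  shows "orbital_graphs \<Omega> (conjugate \<Omega> x G) = rename_digraph x ` orbital_graphs \<Omega> G"
proof (intro subset_antisym subsetI)
  fix \<Gamma> assume "\<Gamma> \<in> orbital_graphs \<Omega> (conjugate \<Omega> x G)"
  then obtain \<alpha> \<beta> where "\<alpha> \<in> \<Omega>" "\<beta> \<in> \<Omega>" and \<Gamma>: "\<Gamma> = orbital_graph \<Omega> (conjugate \<Omega> x G) \<alpha> \<beta>"
    by (auto simp: orbital_graphs_def)
  then obtain \<alpha>' \<beta>' where "\<alpha>' \<in> \<Omega>" "\<beta>' \<in> \<Omega>" "\<alpha> = x \<alpha>'" "\<beta> = x \<beta>'"
    by (metis assms imageE permutes_image)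
  then show "\<Gamma> \<in> rename_digraph x ` orbital_graphs \<Omega> G"
    unfolding \<Gamma> orbital_graphs_def
    by (auto simp flip: rename_orbital_graph[OF assms])
next
  fix \<Gamma> assume "\<Gamma> \<in> rename_digraph x ` orbital_graphs \<Omega> G"
  then obtain \<alpha> \<beta> where "\<alpha> \<in> \<Omega>" "\<beta> \<in> \<Omega>" "\<Gamma> = rename_digraph x (orbital_graph \<Omega> G \<alpha> \<beta>)"
    by (auto simp: orbital_graphs_def)
  then show "\<Gamma> \<in> orbital_graphs \<Omega> (conjugate \<Omega> x G)"
    unfolding orbital_graphs_def rename_orbital_graph[OF assms] using permutes_in_image[OF assms] by blast
qed

lemma orbitals_conjugate_cong:
  assumes "x permutes \<Omega>" and "orbitals \<Omega> G = orbitals \<Omega> H"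
  shows "orbitals \<Omega> (conjugate \<Omega> x G) = orbitals \<Omega> (conjugate \<Omega> x H)"
  using assms by (metis orbital_graphs_conjugate orbital_graphs_eq_iff)

section \<open>2-closed groups\<close>

text \<open>Gives \<open>GREATEST\<close> in \<open>two_closure\<close> its meaning. The witness is
  the group of all permutations that map every orbital of \<open>G\<close> onto itself.\<close>

lemma greatest_with_same_orbitals:
  assumes G: "subgroup G (Sym \<Omega>)"
  shows "\<exists>M. (subgroup M (Sym \<Omega>) \<and> orbitals \<Omega> M = orbitals \<Omega> G) \<and>
    (\<forall>K. subgroup K (Sym \<Omega>) \<and> orbitals \<Omega> K = orbitals \<Omega> G \<longrightarrow> K \<subseteq> M)"
proof -
  define M where "M = {g. g permutes \<Omega> \<and> (\<forall>A\<in>orbitals \<Omega> G. map_prod g g ` A = A)}"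
  have maximal: "K \<subseteq> M" if K: "subgroup K (Sym \<Omega>)" and eq: "orbitals \<Omega> K = orbitals \<Omega> G" for K
  proof
    fix g assume g: "g \<in> K"
    have perm: "g permutes \<Omega>"
      using K g by (auto simp: subgroup_Sym_iff)
    \<comment> \<open>Translating the index set \<open>K\<close> by \<open>g\<close> moves each pair
      \<open>(h \<alpha>, h \<beta>)\<close> by \<open>g\<close>, so invariance of \<open>K\<close>
      under translation makes every orbital of \<open>K\<close> invariant under
      \<open>g\<close>.\<close>
    have "(\<circ>) g ` K = K"
    proof (intro subset_antisym subsetI)
      fix h assume "h \<in> (\<circ>) g ` K"
      then show "h \<in> K"
        using K g unfolding subgroup_Sym_iff by blast
    next
      fix h assume "h \<in> K"
      then have "inv_into UNIV g \<circ> h \<in> K"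
        using K g unfolding subgroup_Sym_iff by blast
      moreover have "h = g \<circ> (inv_into UNIV g \<circ> h)"
        using permutes_inverses[OF perm] by (simp add: fun_eq_iff)
      ultimately show "h \<in> (\<circ>) g ` K"
        by (metis image_eqI)
    qed
    moreover have "map_prod g g ` (\<lambda>h. (h \<alpha>, h \<beta>)) ` K = (\<lambda>h. (h \<alpha>, h \<beta>)) ` (\<circ>) g ` K" for \<alpha> \<beta>
      by (simp add: image_image)
    ultimately have "\<forall>A\<in>orbitals \<Omega> K. map_prod g g ` A = A"
      unfolding orbitals_eq by simp
    then show "g \<in> M"
      using perm eq by (simp add: M_def)
  qed
  have stab_inv: "map_prod (inv_into UNIV g) (inv_into UNIV g) ` A = A"
    if "map_prod g g ` A = A" "g permutes \<Omega>" for g A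
  proof -
    have "map_prod (inv_into UNIV g) (inv_into UNIV g) ` map_prod g g ` A = A"
      using that(2) by (simp add: image_image map_prod_def case_prod_unfold permutes_inverses)
    with that(1) show ?thesis by simp
  qed
  have stab_comp: "map_prod (h \<circ> g) (h \<circ> g) ` A = A"
    if "map_prod g g ` A = A" "map_prod h h ` A = A" for g h :: "'a \<Rightarrow> 'a" and A
  proof -
    have "map_prod (h \<circ> g) (h \<circ> g) ` A = map_prod h h ` map_prod g g ` A"
      by (simp only: image_comp map_prod.comp)
    with that show ?thesis by simp
  qed
  have M: "subgroup M (Sym \<Omega>)"
    unfolding subgroup_Sym_iff
  proof (intro conjI ballI)
    show "M \<subseteq> {p. p permutes \<Omega>}" by (auto simp: M_def)
    show "id \<in> M" by (simp add: M_def map_prod.id permutes_id)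
    show "h \<circ> g \<in> M" if "g \<in> M" "h \<in> M" for g h
      unfolding M_def mem_Collect_eq
    proof (intro conjI ballI)
      show "h \<circ> g permutes \<Omega>"
        using that by (simp add: M_def permutes_compose)
      show "map_prod (h \<circ> g) (h \<circ> g) ` A = A" if "A \<in> orbitals \<Omega> G" for A
        using \<open>g \<in> M\<close> \<open>h \<in> M\<close> that unfolding M_def by (intro stab_comp) simp_all
    qed
    show "inv_into UNIV g \<in> M" if "g \<in> M" for g
      unfolding M_def mem_Collect_eq
    proof (intro conjI ballI)
      show "inv_into UNIV g permutes \<Omega>"
        using that by (simp add: M_def permutes_inv)
      show "map_prod (inv_into UNIV g) (inv_into UNIV g) ` A = A" if "A \<in> orbitals \<Omega> G" for A
        using \<open>g \<in> M\<close> that unfolding M_def by (intro stab_inv) simp_all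
    qed
  qed
  \<comment> \<open>Each orbit of \<open>G\<close> contains its base-pair and is fixed setwise by
    \<open>M\<close>, so it contains the orbit of \<open>M\<close>. The other inclusion comes from
    \<open>maximal\<close> for \<open>G\<close> itself.\<close>
  have "(\<lambda>h. (h \<alpha>, h \<beta>)) ` M = (\<lambda>h. (h \<alpha>, h \<beta>)) ` G" if "\<alpha> \<in> \<Omega>" "\<beta> \<in> \<Omega>" for \<alpha> \<beta>
  proof (intro subset_antisym image_subsetI)
    let ?A = "(\<lambda>h. (h \<alpha>, h \<beta>)) ` G"
    have A: "?A \<in> orbitals \<Omega> G"
      using that unfolding orbitals_eq by (intro image_eqI[of _ _ "(\<alpha>, \<beta>)"]) auto
    have mem: "(\<alpha>, \<beta>) \<in> ?A"
      using G by (intro image_eqI[of _ _ id]) (auto simp: subgroup_Sym_iff)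
    fix h assume "h \<in> M"
    then have "map_prod h h ` ?A = ?A"
      using A unfolding M_def by blast
    with imageI[OF mem, of "map_prod h h"] show "(h \<alpha>, h \<beta>) \<in> ?A"
      by (simp only: map_prod_simp)
  next
    fix h assume "h \<in> G"
    then show "(h \<alpha>, h \<beta>) \<in> (\<lambda>h. (h \<alpha>, h \<beta>)) ` M"
      using maximal[OF G refl] by blast
  qed
  then have "orbitals \<Omega> M = orbitals \<Omega> G"
    unfolding orbitals_eq by (intro image_cong refl) (simp add: case_prod_unfold mem_Times_iff)
  with M maximal show ?thesis
    by blast
qed

text \<open>\<open>G\<close> always lies in the greatest group \<open>M\<close> with its orbitals,
  so equality with \<open>M\<close> amounts to containing every competitor \<open>K\<close>. Later
  proofs use this form in place of \<open>GREATEST\<close>.\<close>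

lemma two_closed_iff:
  "G \<in> two_closed_subgroups \<Omega> \<longleftrightarrow> subgroup G (Sym \<Omega>) \<and>
     (\<forall>K. subgroup K (Sym \<Omega>) \<and> orbitals \<Omega> K = orbitals \<Omega> G \<longrightarrow> K \<subseteq> G)"
proof (cases "subgroup G (Sym \<Omega>)")
  case True
  then obtain M where M: "subgroup M (Sym \<Omega>) \<and> orbitals \<Omega> M = orbitals \<Omega> G"
    and maximal: "\<forall>K. subgroup K (Sym \<Omega>) \<and> orbitals \<Omega> K = orbitals \<Omega> G \<longrightarrow> K \<subseteq> M"
    using greatest_with_same_orbitals by blast
  have "two_closure \<Omega> G = M"
    unfolding two_closure_def by (rule Greatest_equality) (use M maximal in blast)+
  with True M maximal show ?thesis
    unfolding two_closed_subgroups_def by blast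
qed (simp add: two_closed_subgroups_def)

text \<open>Conjugating back by the inverse of \<open>x\<close> turns a group with the orbitals of
  the conjugate into one with the orbitals of \<open>G\<close>, which therefore lies in
  \<open>G\<close>.\<close>

lemma two_closed_conjugate:
  assumes G: "G \<in> two_closed_subgroups \<Omega>" and x: "x permutes \<Omega>"
  shows "conjugate \<Omega> x G \<in> two_closed_subgroups \<Omega>"
  unfolding two_closed_iff
proof (intro conjI allI impI; (elim conjE)?)
  show "subgroup (conjugate \<Omega> x G) (Sym \<Omega>)"
    using G x by (simp add: two_closed_iff subgroup_conjugate)
  fix K assume K: "subgroup K (Sym \<Omega>)" "orbitals \<Omega> K = orbitals \<Omega> (conjugate \<Omega> x G)"
  let ?x' = "inv_into UNIV x"
  have x': "?x' permutes \<Omega>" using x by (rule permutes_inv)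
  have "orbitals \<Omega> (conjugate \<Omega> ?x' K) = orbitals \<Omega> G"
    using orbitals_conjugate_cong[OF x' K(2)] conjugate_inv_conjugate[OF x] by simp
  then have "conjugate \<Omega> ?x' K \<subseteq> G"
    using G subgroup_conjugate[OF x' K(1)] by (auto simp: two_closed_iff)
  then show "K \<subseteq> conjugate \<Omega> x G"
    using conjugate_mono[OF x] conjugate_conjugate_inv[OF x] by metis
qed

text \<open>Two 2-closed groups with equal orbitals are competitors in each other's maximality, so
  they contain each other.\<close>

lemma inj_on_orbital_graphs: "inj_on (orbital_graphs \<Omega>) (two_closed_subgroups \<Omega>)"
  by (rule inj_onI) (metis orbital_graphs_eq_iff subset_antisym two_closed_iff)

text \<open>The conjugate of \<open>G\<close> is again 2-closed, so injectivity applies to it and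
  \<open>H\<close>; invariance then rewrites its orbital graphs as renamings of those of
  \<open>G\<close>.\<close>

lemma conjugators_eq_Transp:
  assumes "G \<in> two_closed_subgroups \<Omega>" and "H \<in> two_closed_subgroups \<Omega>"
  shows "{x \<in> carrier (Sym \<Omega>). conjugate \<Omega> x G = H} =
    Transp \<Omega> (\<lambda>g A. rename_digraph g ` A) (orbital_graphs \<Omega> G) (orbital_graphs \<Omega> H)"
proof -
  have "conjugate \<Omega> x G = H \<longleftrightarrow> rename_digraph x ` orbital_graphs \<Omega> G = orbital_graphs \<Omega> H"
    if "x permutes \<Omega>" for x
    using inj_on_eq_iff[OF inj_on_orbital_graphs two_closed_conjugate[OF assms(1) that] assms(2)]
      orbital_graphs_conjugate[OF that, of G] by simp
  then show ?thesis
    by (auto simp only: Transp_def Sym_simps mem_Collect_eq)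
qed

text \<open>The library's \<open>normalizer\<close> conjugates as x G x^{-1}, opposite to
  \<open>conjugate\<close>; fixing \<open>G\<close> under one is equivalent to fixing it under the
  other.\<close>

lemma normalizer_eq_conjugators:
  assumes "subgroup G (Sym \<Omega>)"
  shows "normalizer (Sym \<Omega>) G = {x \<in> carrier (Sym \<Omega>). conjugate \<Omega> x G = G}"
proof -
  have "x <#\<^bsub>Sym \<Omega>\<^esub> G #>\<^bsub>Sym \<Omega>\<^esub> inv_into UNIV x = G \<longleftrightarrow> conjugate \<Omega> x G = G" if x: "x permutes \<Omega>" for x
  proof -
    have "x <#\<^bsub>Sym \<Omega>\<^esub> G #>\<^bsub>Sym \<Omega>\<^esub> inv_into UNIV x = conjugate \<Omega> (inv_into UNIV x) G"
      using permutes_inv[OF x] permutes_inv_inv[OF x] by (simp add: conjugate_def)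
    then show ?thesis
      using x by (metis conjugate_conjugate_inv conjugate_inv_conjugate)
  qed
  then show ?thesis
    using subgroup.subset[OF assms]
    by (simp add: normalizer_def stabilizer_def cong: conj_cong)
qed

section \<open>Renaming labelled digraphs\<close>

lemma rename_digraph_comp:
  "rename_digraph (f \<circ> g) \<Gamma> = rename_digraph f (rename_digraph g \<Gamma>)"
  by (simp add: rename_digraph_def image_comp map_prod.comp)

lemma rename_digraph_id [simp]: "rename_digraph id \<Gamma> = \<Gamma>"
  by (simp add: rename_digraph_def map_prod.id)

lemma rename_labelled_id [simp]: "rename_labelled id \<Gamma> = \<Gamma>"
  by (simp add: rename_labelled_def map_prod.id)

lemma rename_labelled_comp:
  assumes "bij f" and "bij g"
  shows "rename_labelled (f \<circ> g) \<Gamma> = rename_labelled f (rename_labelled g \<Gamma>)"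
  using assms
  by (simp add: rename_labelled_def rename_digraph_comp o_inv_distrib comp_assoc map_prod.comp)

text \<open>Since \<open>f\<close> is onto, it suffices to compare labels at values of
  \<open>f\<close>, which avoids the inverse in \<open>rename_labelled\<close>.\<close>

lemma rename_labelled_eqI:
  assumes "bij f"
    and "rename_digraph f (digraph \<Gamma>) = digraph \<Delta>"
    and "\<And>v. vlabel \<Delta> (f v) = vlabel \<Gamma> v"
    and "\<And>u v. alabel \<Delta> (f u, f v) = alabel \<Gamma> (u, v)"
  shows "rename_labelled f \<Gamma> = \<Delta>"
proof -
  have "f (inv_into UNIV f v) = v" for v
    using assms(1) by (simp add: bij_is_surj surj_f_inv_f)
  then have "vlabel \<Gamma> \<circ> inv_into UNIV f = vlabel \<Delta>"
    and "alabel \<Gamma> \<circ> map_prod (inv_into UNIV f) (inv_into UNIV f) = alabel \<Delta>"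
    using assms(3,4) by (auto simp: fun_eq_iff simp flip: assms(3,4))
  with assms(2) show ?thesis
    by (simp add: rename_labelled_def)
qed

lemma vlabel_rename_labelled:
  assumes "bij f"
  shows "vlabel (rename_labelled f \<Gamma>) (f v) = vlabel \<Gamma> v"
  using assms by (simp add: rename_labelled_def bij_is_inj inv_f_f)

lemma arc_rename_labelled:
  assumes "bij f"
  shows "(f u, f v) \<in> parcs (digraph (rename_labelled f \<Gamma>)) \<longleftrightarrow> (u, v) \<in> parcs (digraph \<Gamma>)"
  using assms by (auto simp: rename_labelled_def rename_digraph_def bij_def dest: injD)

section \<open>Orbits of labelled digraphs\<close>

abbreviation labelled_orbit :: "'a set \<Rightarrow> ('a, 'l) labelled_digraph \<Rightarrow> ('a, 'l) labelled_digraph set"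
  where "labelled_orbit N \<Gamma> \<equiv> Group_Action.orbit (Sym N) rename_labelled \<Gamma>"

lemma labelled_orbit_eq: "labelled_orbit N \<Gamma> = (\<lambda>h. rename_labelled h \<Gamma>) ` {h. h permutes N}"
  by (auto simp: Group_Action.orbit_def)

lemma labelled_orbit_self: "\<Gamma> \<in> labelled_orbit N \<Gamma>"
  unfolding labelled_orbit_eq by (rule image_eqI[of _ _ id]) (simp_all add: permutes_id)

text \<open>Composing permutations gives one inclusion for all permutations and digraphs; applied to
  the inverse of \<open>h\<close> and the renamed digraph it gives the other.\<close>

lemma labelled_orbit_rename:
  assumes h: "h permutes N"
  shows "labelled_orbit N (rename_labelled h \<Gamma>) = labelled_orbit N \<Gamma>"
proof -
  have "labelled_orbit N (rename_labelled p \<Gamma>) \<subseteq> labelled_orbit N \<Gamma>" if p: "p permutes N" for p \<Gamma>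
    unfolding labelled_orbit_eq
  proof (intro image_subsetI)
    fix q assume "q \<in> {q. q permutes N}"
    then show "rename_labelled q (rename_labelled p \<Gamma>)
        \<in> (\<lambda>h. rename_labelled h \<Gamma>) ` {h. h permutes N}"
      using p by (intro image_eqI[of _ _ "q \<circ> p"])
        (simp_all add: permutes_compose rename_labelled_comp permutes_bij)
  qed
  from this[OF h, of \<Gamma>] this[OF permutes_inv[OF h], of "rename_labelled h \<Gamma>"] show ?thesis
    unfolding rename_labelled_comp[OF permutes_bij[OF permutes_inv[OF h]] permutes_bij[OF h], symmetric]
      permutes_inv_o[OF h] rename_labelled_id by (rule subset_antisym)
qed

lemma labelled_orbit_cong:
  assumes "\<Delta> \<in> labelled_orbit N \<Gamma>"
  shows "labelled_orbit N \<Delta> = labelled_orbit N \<Gamma>"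
proof -
  obtain h where "h permutes N" "\<Delta> = rename_labelled h \<Gamma>"
    using assms by (auto simp: labelled_orbit_eq)
  then show ?thesis
    by (simp only: labelled_orbit_rename)
qed

lemma permutes_disjoint_commute:
  assumes "g permutes A" and "h permutes B" and "A \<inter> B = {}"
  shows "g \<circ> h = h \<circ> g"
proof
  fix v
  have "g w \<in> A \<longleftrightarrow> w \<in> A" "w \<notin> A \<Longrightarrow> g w = w" "h w \<in> B \<longleftrightarrow> w \<in> B" "w \<notin> B \<Longrightarrow> h w = w" for w
    using assms(1,2) by (simp_all add: permutes_in_image permutes_not_in)
  with assms(3) show "(g \<circ> h) v = (h \<circ> g) v"
    by (cases "v \<in> A"; cases "v \<in> B") (auto simp: disjoint_iff)
qed

text \<open>\<open>g\<close> and the permutations of \<open>N\<close> move disjoint sets, hence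
  commute, so \<open>g\<close> can be carried past the renamings that form the orbit.\<close>

lemma rename_extended_orbit:
  assumes g: "g permutes \<Omega>" and disj: "\<Omega> \<inter> N = {}"
  shows "rename_extended g (labelled_orbit N \<Gamma>) = labelled_orbit N (rename_labelled g \<Gamma>)"
proof -
  have "rename_labelled g (rename_labelled h \<Gamma>) = rename_labelled h (rename_labelled g \<Gamma>)"
    if h: "h permutes N" for h
    using permutes_disjoint_commute[OF g h disj]
    by (metis rename_labelled_comp permutes_bij g h)
  then show ?thesis
    unfolding rename_extended_def labelled_orbit_eq image_image by (intro image_cong) simp_all
qed

section \<open>The digraph underlying \<open>\<psi>\<close>\<close>

text \<open>What the digraph of \<psi> needs of its choices, freed from \<Lambda> and its
  enumeration: the digraphs live on \<Omega>, and the original vertices, their copies and the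
  \<open>x i\<close> are all distinct.\<close>

locale psi_layout =
  fixes \<Omega> :: "'a set" and k :: nat
    and \<Gamma> :: "nat \<Rightarrow> 'a pair_pre_digraph" and \<tau> :: "nat \<Rightarrow> 'a \<Rightarrow> 'a" and x :: "nat \<Rightarrow> 'a"
  assumes arcs_Omega: "i < k \<Longrightarrow> parcs (\<Gamma> i) \<subseteq> \<Omega> \<times> \<Omega>"
    and tau_inj: "\<lbrakk>i < k; j < k; \<alpha> \<in> \<Omega>; \<beta> \<in> \<Omega>; \<tau> i \<alpha> = \<tau> j \<beta>\<rbrakk> \<Longrightarrow> i = j \<and> \<alpha> = \<beta>"
    and tau_notin: "\<lbrakk>i < k; \<alpha> \<in> \<Omega>\<rbrakk> \<Longrightarrow> \<tau> i \<alpha> \<notin> \<Omega>"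
    and x_inj: "\<lbrakk>i < k; j < k; x i = x j\<rbrakk> \<Longrightarrow> i = j"
    and x_notin: "i < k \<Longrightarrow> x i \<notin> \<Omega>"
    and tau_neq_x: "\<lbrakk>i < k; j < k; \<alpha> \<in> \<Omega>\<rbrakk> \<Longrightarrow> \<tau> i \<alpha> \<noteq> x j"
begin

abbreviation \<Delta> :: "'a pair_pre_digraph" where
  "\<Delta> \<equiv> psi_digraph \<Omega> k \<Gamma> \<tau> x"

lemma pverts_Delta: "pverts \<Delta> = \<Omega> \<union> (\<Union>i<k. \<tau> i ` \<Omega>) \<union> x ` {..<k}"
  by (simp add: psi_digraph_def)

text \<open>All arcs start in a copy of \<Omega>, so one description by the source covers the three
  kinds; for copied arcs, \<open>arcs_Omega\<close> supplies
  \<open>\<alpha> \<in> \<Omega>\<close>.\<close>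

lemma parcs_Delta_iff:
  "(u, v) \<in> parcs \<Delta> \<longleftrightarrow> (\<exists>i<k. \<exists>\<alpha>\<in>\<Omega>. u = \<tau> i \<alpha> \<and>
     (v = \<alpha> \<or> v = x i \<or> (\<exists>\<beta>. v = \<tau> i \<beta> \<and> (\<alpha>, \<beta>) \<in> parcs (\<Gamma> i))))"
proof
  assume "(u, v) \<in> parcs \<Delta>"
  then obtain i where i: "i < k" and "(u, v) \<in> {(\<tau> i \<alpha>, \<alpha>) | \<alpha>. \<alpha> \<in> \<Omega>} \<union> {(\<tau> i \<alpha>, x i) | \<alpha>. \<alpha> \<in> \<Omega>}
      \<union> {(\<tau> i \<alpha>, \<tau> i \<beta>) | \<alpha> \<beta>. (\<alpha>, \<beta>) \<in> parcs (\<Gamma> i)}"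
    by (auto simp: psi_digraph_def)
  then consider \<alpha> where "\<alpha> \<in> \<Omega>" "u = \<tau> i \<alpha>" "v = \<alpha> \<or> v = x i"
    | \<alpha> \<beta> where "(\<alpha>, \<beta>) \<in> parcs (\<Gamma> i)" "u = \<tau> i \<alpha>" "v = \<tau> i \<beta>"
    by blast
  then show "\<exists>i<k. \<exists>\<alpha>\<in>\<Omega>. u = \<tau> i \<alpha> \<and>
     (v = \<alpha> \<or> v = x i \<or> (\<exists>\<beta>. v = \<tau> i \<beta> \<and> (\<alpha>, \<beta>) \<in> parcs (\<Gamma> i)))"
    using i arcs_Omega[OF i] by cases blast+
qed (auto simp: psi_digraph_def)

text \<open>Arcs of the other two kinds end outside \<Omega>. Hence each vertex of a copy remembers
  its original.\<close>

lemma arc_to_Omega_iff: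
  assumes "i < k" "\<alpha> \<in> \<Omega>" "\<beta> \<in> \<Omega>"
  shows "(\<tau> i \<alpha>, \<beta>) \<in> parcs \<Delta> \<longleftrightarrow> \<alpha> = \<beta>"
proof
  assume "(\<tau> i \<alpha>, \<beta>) \<in> parcs \<Delta>"
  then show "\<alpha> = \<beta>"
    using assms arcs_Omega unfolding parcs_Delta_iff
    by (metis (no_types, lifting) mem_Sigma_iff subsetD tau_inj tau_notin x_notin)
qed (use assms in \<open>auto simp: parcs_Delta_iff\<close>)

text \<open>No \<open>x i\<close> lies in \<Omega> or in a copy, so an arc into it is of the second
  kind, and injectivity of \<open>x\<close> gives the index. Hence \<open>x i\<close> identifies its
  copy.\<close>

lemma arc_to_x_iff:
  assumes "i < k"
  shows "(u, x i) \<in> parcs \<Delta> \<longleftrightarrow> (\<exists>\<alpha>\<in>\<Omega>. u = \<tau> i \<alpha>)"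
proof
  assume "(u, x i) \<in> parcs \<Delta>"
  then obtain j \<alpha> where *: "j < k" "\<alpha> \<in> \<Omega>" "u = \<tau> j \<alpha>"
    "x i = \<alpha> \<or> x i = x j \<or> (\<exists>\<beta>. x i = \<tau> j \<beta> \<and> (\<alpha>, \<beta>) \<in> parcs (\<Gamma> j))"
    unfolding parcs_Delta_iff by blast
  then have "x i = x j"
    using assms x_notin tau_neq_x arcs_Omega by (metis mem_Sigma_iff subsetD)
  then show "\<exists>\<alpha>\<in>\<Omega>. u = \<tau> i \<alpha>"
    using * x_inj assms by blast
qed (use assms in \<open>auto simp: parcs_Delta_iff\<close>)

text \<open>The source fixes the copy and the vertex in it; the target, lying in a copy, excludes
  the arcs to \<Omega> and to \<open>x i\<close>.\<close>

lemma arc_tau_iff: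
  assumes "i < k" "\<alpha> \<in> \<Omega>" "\<beta> \<in> \<Omega>"
  shows "(\<tau> i \<alpha>, \<tau> i \<beta>) \<in> parcs \<Delta> \<longleftrightarrow> (\<alpha>, \<beta>) \<in> parcs (\<Gamma> i)"
proof
  assume "(\<tau> i \<alpha>, \<tau> i \<beta>) \<in> parcs \<Delta>"
  then obtain j \<alpha>' where *: "j < k" "\<alpha>' \<in> \<Omega>" "\<tau> i \<alpha> = \<tau> j \<alpha>'"
    "\<tau> i \<beta> = \<alpha>' \<or> \<tau> i \<beta> = x j \<or> (\<exists>\<beta>'. \<tau> i \<beta> = \<tau> j \<beta>' \<and> (\<alpha>', \<beta>') \<in> parcs (\<Gamma> j))"
    unfolding parcs_Delta_iff by blast
  then have eq: "j = i" "\<alpha>' = \<alpha>"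
    using tau_inj assms by blast+
  then obtain \<beta>' where "\<tau> i \<beta> = \<tau> i \<beta>'" "(\<alpha>, \<beta>') \<in> parcs (\<Gamma> i)"
    using * assms tau_notin tau_neq_x by metis
  then show "(\<alpha>, \<beta>) \<in> parcs (\<Gamma> i)"
    using tau_inj arcs_Omega assms by (metis mem_Sigma_iff subsetD)
qed (use assms in \<open>auto simp: parcs_Delta_iff\<close>)

lemma wf_Delta: "pair_wf_digraph \<Delta>"
proof
  fix e assume "e \<in> parcs \<Delta>"
  then have "(fst e, snd e) \<in> parcs \<Delta>" by simp
  then show "fst e \<in> pverts \<Delta>" "snd e \<in> pverts \<Delta>"
    using arcs_Omega unfolding parcs_Delta_iff pverts_Delta by auto
qed

context
  fixes lab0 lab_hash lab_ast :: 'l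
  assumes distinct_labels: "distinct [lab0, lab_hash, lab_ast]"
begin

abbreviation \<Psi> :: "('a, 'l) labelled_digraph" where
  "\<Psi> \<equiv> psi_labelled_digraph lab0 lab_hash lab_ast \<Omega> k \<Gamma> \<tau> x"

lemma digraph_Psi [simp]: "digraph \<Psi> = \<Delta>"
  by (simp add: psi_labelled_digraph_def Let_def)

text \<open>\<open>psi_label\<close> tests for \<Omega> first, so besides distinctness of the labels
  this uses that the \<open>x i\<close> lie outside \<Omega>.\<close>

lemma vlabel_Psi_ast_iff: "vlabel \<Psi> v = Some lab_ast \<longleftrightarrow> v \<in> x ` {..<k}"
  using distinct_labels x_notin
  by (auto simp: psi_labelled_digraph_def Let_def psi_label_def pverts_Delta)

lemma Psi_labelled_digraphs_on: "\<Psi> \<in> labelled_digraphs_on (pverts \<Delta>)"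
  using wf_Delta
  by (auto simp: labelled_digraphs_on_def digraphs_on_def psi_labelled_digraph_def Let_def dom_def)

end

end

text \<open>The label of \<open>x i\<close> is carried to that of some \<open>x' j\<close>; arcs into \<open>x' j\<close> and into
  \<open>\<Omega>\<close> then force \<open>\<tau> i \<alpha>\<close> to go to \<open>\<tau>' j (g \<alpha>)\<close>, so the copy of \<open>\<Gamma> i\<close> is carried to that
  of \<open>\<Gamma>' j\<close>.\<close>

lemma psi_labelled_digraph_rename_component:
  fixes lab0 lab_hash lab_ast :: 'l
  assumes A: "psi_layout \<Omega> k \<Gamma> \<tau> x" and B: "psi_layout \<Omega> k' \<Gamma>' \<tau>' x'"
    and labels: "distinct [lab0, lab_hash, lab_ast]"
    and g: "g permutes \<Omega>" and \<sigma>: "bij \<sigma>" and \<sigma>_g: "\<And>\<alpha>. \<alpha> \<in> \<Omega> \<Longrightarrow> \<sigma> \<alpha> = g \<alpha>"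
    and rename: "rename_labelled \<sigma> (psi_labelled_digraph lab0 lab_hash lab_ast \<Omega> k \<Gamma> \<tau> x)
      = psi_labelled_digraph lab0 lab_hash lab_ast \<Omega> k' \<Gamma>' \<tau>' x'"
    and i: "i < k"
  obtains j where "j < k'" and "parcs (\<Gamma>' j) = map_prod g g ` parcs (\<Gamma> i)"
proof -
  interpret A: psi_layout \<Omega> k \<Gamma> \<tau> x by (rule A)
  interpret B: psi_layout \<Omega> k' \<Gamma>' \<tau>' x' by (rule B)
  let ?A = "psi_labelled_digraph lab0 lab_hash lab_ast \<Omega> k \<Gamma> \<tau> x"
  let ?B = "psi_labelled_digraph lab0 lab_hash lab_ast \<Omega> k' \<Gamma>' \<tau>' x'"
  have arc: "(\<sigma> u, \<sigma> v) \<in> parcs B.\<Delta> \<longleftrightarrow> (u, v) \<in> parcs A.\<Delta>" for u v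
    using arc_rename_labelled[OF \<sigma>, of u v ?A]
    by (simp add: rename A.digraph_Psi[OF labels] B.digraph_Psi[OF labels])
  have "vlabel ?B (\<sigma> (x i)) = vlabel ?A (x i)"
    using vlabel_rename_labelled[OF \<sigma>, of ?A "x i"] by (simp add: rename)
  moreover have "vlabel ?A (x i) = Some lab_ast"
    using i by (simp add: A.vlabel_Psi_ast_iff[OF labels])
  ultimately have "\<sigma> (x i) \<in> x' ` {..<k'}"
    by (simp add: B.vlabel_Psi_ast_iff[OF labels])
  then obtain j where j: "j < k'" "\<sigma> (x i) = x' j" by auto
  have in_Omega: "g \<alpha> \<in> \<Omega> \<longleftrightarrow> \<alpha> \<in> \<Omega>" for \<alpha>
    using g by (rule permutes_in_image)
  have \<sigma>_\<tau>: "\<sigma> (\<tau> i \<alpha>) = \<tau>' j (g \<alpha>)" if \<alpha>: "\<alpha> \<in> \<Omega>" for \<alpha>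
  proof -
    have "(\<tau> i \<alpha>, x i) \<in> parcs A.\<Delta>"
      using \<alpha> A.arc_to_x_iff[OF i] by blast
    then have "(\<sigma> (\<tau> i \<alpha>), x' j) \<in> parcs B.\<Delta>"
      using arc[of "\<tau> i \<alpha>" "x i"] j(2) by simp
    then obtain \<beta> where \<beta>: "\<beta> \<in> \<Omega>" "\<sigma> (\<tau> i \<alpha>) = \<tau>' j \<beta>"
      using B.arc_to_x_iff[OF j(1)] by blast
    have "(\<tau> i \<alpha>, \<alpha>) \<in> parcs A.\<Delta>"
      using A.arc_to_Omega_iff[OF i \<alpha> \<alpha>] by simp
    then have "(\<tau>' j \<beta>, g \<alpha>) \<in> parcs B.\<Delta>"
      using arc[of "\<tau> i \<alpha>" \<alpha>] \<beta>(2) \<sigma>_g[OF \<alpha>] by simp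
    then show ?thesis
      using B.arc_to_Omega_iff[OF j(1) \<beta>(1)] in_Omega \<alpha> \<beta>(2) by simp
  qed
  have iff: "(g \<alpha>, g \<beta>) \<in> parcs (\<Gamma>' j) \<longleftrightarrow> (\<alpha>, \<beta>) \<in> parcs (\<Gamma> i)" if "\<alpha> \<in> \<Omega>" "\<beta> \<in> \<Omega>" for \<alpha> \<beta>
    using arc[of "\<tau> i \<alpha>" "\<tau> i \<beta>"] A.arc_tau_iff[OF i that] B.arc_tau_iff[OF j(1), of "g \<alpha>" "g \<beta>"]
      that \<sigma>_\<tau> in_Omega by simp
  have "parcs (\<Gamma>' j) = map_prod g g ` parcs (\<Gamma> i)"
  proof (intro subset_antisym subsetI)
    fix e assume e: "e \<in> parcs (\<Gamma>' j)"
    obtain \<alpha> \<beta> where \<alpha>\<beta>: "e = (g \<alpha>, g \<beta>)"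
      by (metis permutes_inverses(1)[OF g] surj_pair)
    with e have "\<alpha> \<in> \<Omega>" "\<beta> \<in> \<Omega>"
      using B.arcs_Omega[OF j(1)] in_Omega by auto
    then have "(\<alpha>, \<beta>) \<in> parcs (\<Gamma> i)"
      using iff e \<alpha>\<beta> by simp
    then show "e \<in> map_prod g g ` parcs (\<Gamma> i)"
      using \<alpha>\<beta> by (metis image_eqI map_prod_simp)
  next
    fix e assume "e \<in> map_prod g g ` parcs (\<Gamma> i)"
    then obtain \<alpha> \<beta> where "(\<alpha>, \<beta>) \<in> parcs (\<Gamma> i)" "e = (g \<alpha>, g \<beta>)" by auto
    then show "e \<in> parcs (\<Gamma>' j)"
      using A.arcs_Omega[OF i] iff by blast
  qed
  with j(1) show thesis by (rule that)
qed

text \<open>The isomorphism acts as \<open>g\<close> on \<Omega>, sends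
  \<open>\<tau> i \<alpha>\<close> to \<open>\<tau>' (\<pi> i) (g \<alpha>)\<close> and
  \<open>x i\<close> to \<open>x' (\<pi> i)\<close>. It preserves the three kinds of arcs and the
  three classes of vertices, hence the labels.\<close>

lemma psi_labelled_digraph_extend_renaming:
  fixes lab0 lab_hash lab_ast :: 'l
  assumes A: "psi_layout \<Omega> k \<Gamma> \<tau> x" and B: "psi_layout \<Omega> k \<Gamma>' \<tau>' x'"
    and labels: "distinct [lab0, lab_hash, lab_ast]"
    and fin: "finite \<Omega>" and g: "g permutes \<Omega>" and \<pi>: "\<pi> permutes {..<k}"
    and \<Gamma>': "\<And>i. i < k \<Longrightarrow> parcs (\<Gamma>' (\<pi> i)) = map_prod g g ` parcs (\<Gamma> i)"
    and verts: "pverts (psi_digraph \<Omega> k \<Gamma>' \<tau>' x') = pverts (psi_digraph \<Omega> k \<Gamma> \<tau> x)"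
  shows "\<exists>\<sigma>. \<sigma> permutes pverts (psi_digraph \<Omega> k \<Gamma> \<tau> x) \<and> (\<forall>\<alpha>\<in>\<Omega>. \<sigma> \<alpha> = g \<alpha>) \<and>
    rename_labelled \<sigma> (psi_labelled_digraph lab0 lab_hash lab_ast \<Omega> k \<Gamma> \<tau> x)
      = psi_labelled_digraph lab0 lab_hash lab_ast \<Omega> k \<Gamma>' \<tau>' x'"
proof -
  interpret A: psi_layout \<Omega> k \<Gamma> \<tau> x by (rule A)
  interpret B: psi_layout \<Omega> k \<Gamma>' \<tau>' x' by (rule B)
  let ?T = "\<lambda>(i, \<alpha>). \<tau> i \<alpha>" and ?W = "pverts A.\<Delta>"
  \<comment> \<open>\<open>inv_into\<close> recovers the index and the original from a new vertex;
    the first three cases are disjoint. The identity elsewhere is what \<open>permutes\<close>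
    demands.\<close>
  define \<sigma> where "\<sigma> v =
    (if v \<in> \<Omega> then g v
     else if v \<in> x ` {..<k} then x' (\<pi> (inv_into {..<k} x v))
     else if v \<in> ?T ` ({..<k} \<times> \<Omega>)
       then (case inv_into ({..<k} \<times> \<Omega>) ?T v of (i, \<alpha>) \<Rightarrow> \<tau>' (\<pi> i) (g \<alpha>))
     else v)" for v
  have \<pi>_less: "\<pi> i < k \<longleftrightarrow> i < k" for i
    using permutes_in_image[OF \<pi>, of i] by simp
  have in_Omega: "g \<alpha> \<in> \<Omega> \<longleftrightarrow> \<alpha> \<in> \<Omega>" for \<alpha>
    using g by (rule permutes_in_image)
  have \<sigma>_Omega: "\<sigma> \<alpha> = g \<alpha>" if "\<alpha> \<in> \<Omega>" for \<alpha>
    using that by (simp add: \<sigma>_def)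
  have "inj_on x {..<k}"
    using A.x_inj by (auto simp: inj_on_def)
  then have \<sigma>_x: "\<sigma> (x i) = x' (\<pi> i)" if "i < k" for i
    using that A.x_notin[OF that] by (simp add: \<sigma>_def)
  have T_inj: "inj_on ?T ({..<k} \<times> \<Omega>)"
    using A.tau_inj by (auto simp: inj_on_def)
  have \<sigma>_\<tau>: "\<sigma> (\<tau> i \<alpha>) = \<tau>' (\<pi> i) (g \<alpha>)" if "i < k" "\<alpha> \<in> \<Omega>" for i \<alpha>
  proof -
    have "inv_into ({..<k} \<times> \<Omega>) ?T (?T (i, \<alpha>)) = (i, \<alpha>)"
      using that by (intro inv_into_f_f[OF T_inj]) simp
    moreover have "\<tau> i \<alpha> \<in> ?T ` ({..<k} \<times> \<Omega>)"
      using that by (intro image_eqI[of _ _ "(i, \<alpha>)"]) auto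
    moreover have "\<tau> i \<alpha> \<notin> \<Omega>" "\<tau> i \<alpha> \<notin> x ` {..<k}"
      using that A.tau_notin A.tau_neq_x by blast+
    ultimately show ?thesis
      by (simp add: \<sigma>_def)
  qed
  have img_Omega: "\<sigma> ` \<Omega> = \<Omega>"
    using permutes_image[OF g] \<sigma>_Omega by simp
  have "\<sigma> ` x ` {..<k} = x' ` \<pi> ` {..<k}"
    unfolding image_image by (intro image_cong) (simp_all add: \<sigma>_x)
  then have img_x: "\<sigma> ` x ` {..<k} = x' ` {..<k}"
    by (simp add: permutes_image[OF \<pi>])
  have "\<sigma> ` \<tau> i ` \<Omega> = \<tau>' (\<pi> i) ` g ` \<Omega>" if "i < k" for i
    unfolding image_image using that by (intro image_cong) (simp_all add: \<sigma>_\<tau>)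
  \<comment> \<open>\<open>g\<close> maps \<Omega> onto itself and \<open>\<pi>\<close> permutes the
    indices, so both disappear from the union of the copies.\<close>
  then have "\<sigma> ` (\<Union>i<k. \<tau> i ` \<Omega>) = (\<Union>i<k. \<tau>' (\<pi> i) ` \<Omega>)"
    by (simp add: image_UN permutes_image[OF g])
  also have "\<dots> = (\<Union>i\<in>\<pi> ` {..<k}. \<tau>' i ` \<Omega>)"
    by simp
  finally have img_\<tau>: "\<sigma> ` (\<Union>i<k. \<tau> i ` \<Omega>) = (\<Union>i<k. \<tau>' i ` \<Omega>)"
    by (simp only: permutes_image[OF \<pi>])
  have "\<sigma> ` ?W = pverts B.\<Delta>"
    unfolding A.pverts_Delta B.pverts_Delta image_Un img_Omega img_x img_\<tau> ..
  then have img_W: "\<sigma> ` ?W = ?W"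
    by (simp only: verts)
  \<comment> \<open>Surjectivity on the finite set \<open>?W\<close> yields injectivity, which
    spares a case analysis.\<close>
  have "finite ?W"
    using fin by (simp add: A.pverts_Delta)
  then have "bij_betw \<sigma> ?W ?W"
    using img_W by (simp add: bij_betw_def eq_card_imp_inj_on)
  moreover have "\<sigma> v = v" if "v \<notin> ?W" for v
    using that by (auto simp: \<sigma>_def A.pverts_Delta)
  ultimately have perm: "\<sigma> permutes ?W"
    by (rule bij_imp_permutes)
  then have \<sigma>_bij: "bij \<sigma>"
    by (rule permutes_bij)
  then have mem_image: "\<sigma> v \<in> \<sigma> ` S \<longleftrightarrow> v \<in> S" for v S
    by (simp add: bij_is_inj inj_image_mem_iff)
  \<comment> \<open>For an arc of the second digraph, \<open>\<pi>\<close> and \<open>g\<close> are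
    onto, so its index and source are pulled back and the target is matched kind by kind.\<close>
  have "parcs B.\<Delta> = map_prod \<sigma> \<sigma> ` parcs A.\<Delta>"
  proof (intro subset_antisym subsetI)
    fix e assume "e \<in> parcs B.\<Delta>"
    then obtain i \<alpha> where i: "i < k" and \<alpha>: "\<alpha> \<in> \<Omega>" and fst_e: "fst e = \<tau>' i \<alpha>"
      and snd_e: "snd e = \<alpha> \<or> snd e = x' i \<or> (\<exists>\<beta>. snd e = \<tau>' i \<beta> \<and> (\<alpha>, \<beta>) \<in> parcs (\<Gamma>' i))"
      unfolding B.parcs_Delta_iff[of "fst e" "snd e", unfolded prod.collapse] by blast
    obtain j where j: "j < k" "i = \<pi> j"
      using permutes_image[OF \<pi>] i by (metis imageE lessThan_iff)
    obtain \<alpha>' where \<alpha>': "\<alpha>' \<in> \<Omega>" "\<alpha> = g \<alpha>'"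
      using permutes_image[OF g] \<alpha> by (metis imageE)
    have "\<exists>v. snd e = \<sigma> v \<and> (\<tau> j \<alpha>', v) \<in> parcs A.\<Delta>"
      using snd_e
    proof (elim disjE exE conjE)
      assume "snd e = \<alpha>"
      then show ?thesis
        using j \<alpha>' by (intro exI[of _ \<alpha>']) (auto simp: A.parcs_Delta_iff \<sigma>_Omega)
    next
      assume "snd e = x' i"
      then show ?thesis
        using j \<alpha>' by (intro exI[of _ "x j"]) (auto simp: A.parcs_Delta_iff \<sigma>_x)
    next
      fix \<beta> assume \<beta>: "snd e = \<tau>' i \<beta>" "(\<alpha>, \<beta>) \<in> parcs (\<Gamma>' i)"
      then obtain \<alpha>'' \<beta>' where *: "(\<alpha>'', \<beta>') \<in> parcs (\<Gamma> j)" "\<alpha> = g \<alpha>''" "\<beta> = g \<beta>'"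
        using \<Gamma>'[OF j(1)] j(2) by auto
      \<comment> \<open>The source was pulled back twice, once as \<open>\<alpha>'\<close> and once
        as the start of an arc of \<open>\<Gamma> j\<close>; injectivity of \<open>g\<close>
        identifies the two.\<close>
      then have "\<alpha>'' = \<alpha>'" "\<beta>' \<in> \<Omega>"
        using \<alpha>' permutes_inj[OF g] A.arcs_Omega[OF j(1)] by (auto dest: injD)
      then show ?thesis
        using j \<alpha>' * \<beta>(1) by (intro exI[of _ "\<tau> j \<beta>'"]) (auto simp: A.parcs_Delta_iff \<sigma>_\<tau>)
    qed
    then obtain v where "snd e = \<sigma> v" "(\<tau> j \<alpha>', v) \<in> parcs A.\<Delta>" by blast
    moreover have "fst e = \<sigma> (\<tau> j \<alpha>')"
      using fst_e j \<alpha>' by (simp add: \<sigma>_\<tau>)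
    ultimately show "e \<in> map_prod \<sigma> \<sigma> ` parcs A.\<Delta>"
      by (intro image_eqI[of _ _ "(\<tau> j \<alpha>', v)"]) (simp_all add: prod_eq_iff)
  next
    fix e assume "e \<in> map_prod \<sigma> \<sigma> ` parcs A.\<Delta>"
    then obtain u v where e: "e = (\<sigma> u, \<sigma> v)" and "(u, v) \<in> parcs A.\<Delta>" by auto
    then obtain i \<alpha> where i: "i < k" and \<alpha>: "\<alpha> \<in> \<Omega>" and u: "u = \<tau> i \<alpha>"
      and v: "v = \<alpha> \<or> v = x i \<or> (\<exists>\<beta>. v = \<tau> i \<beta> \<and> (\<alpha>, \<beta>) \<in> parcs (\<Gamma> i))"
      unfolding A.parcs_Delta_iff by blast
    have "\<sigma> v = g \<alpha> \<or> \<sigma> v = x' (\<pi> i)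
        \<or> (\<exists>\<beta>. \<sigma> v = \<tau>' (\<pi> i) \<beta> \<and> (g \<alpha>, \<beta>) \<in> parcs (\<Gamma>' (\<pi> i)))"
      using v
    proof (elim disjE exE conjE)
      fix \<beta> assume \<beta>: "v = \<tau> i \<beta>" "(\<alpha>, \<beta>) \<in> parcs (\<Gamma> i)"
      then have "\<beta> \<in> \<Omega>" using A.arcs_Omega[OF i] by blast
      moreover have "(g \<alpha>, g \<beta>) \<in> parcs (\<Gamma>' (\<pi> i))"
        unfolding \<Gamma>'[OF i] using \<beta>(2) by (rule map_prod_imageI)
      ultimately show ?thesis
        using \<beta>(1) i \<sigma>_\<tau> by blast
    qed (use i \<alpha> \<sigma>_x \<sigma>_Omega in simp_all)
    moreover have "\<sigma> u = \<tau>' (\<pi> i) (g \<alpha>)"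
      using u i \<alpha> \<sigma>_\<tau> by simp
    ultimately show "e \<in> parcs B.\<Delta>"
      unfolding e B.parcs_Delta_iff using i \<alpha> \<pi>_less in_Omega by blast
  qed
  then have digraph: "rename_digraph \<sigma> A.\<Delta> = B.\<Delta>"
    using img_W verts by (simp add: rename_digraph_def)
  have arc: "(\<sigma> u, \<sigma> v) \<in> parcs B.\<Delta> \<longleftrightarrow> (u, v) \<in> parcs A.\<Delta>" for u v
  proof -
    have "(\<sigma> u, \<sigma> v) \<in> map_prod \<sigma> \<sigma> ` parcs A.\<Delta> \<longleftrightarrow> (u, v) \<in> parcs A.\<Delta>"
      using bij_is_inj[OF \<sigma>_bij] by (auto dest: injD)
    then show ?thesis
      by (simp flip: digraph add: rename_digraph_def)
  qed
  \<comment> \<open>\<open>\<sigma>\<close> maps \<Omega> onto itself and the \<open>x i\<close>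
    onto the \<open>x' i\<close>, and these two sets decide the label.\<close>
  have label: "psi_label lab0 lab_hash lab_ast \<Omega> (x' ` {..<k}) (\<sigma> v)
      = psi_label lab0 lab_hash lab_ast \<Omega> (x ` {..<k}) v" for v
  proof -
    have "\<sigma> v \<in> \<Omega> \<longleftrightarrow> v \<in> \<Omega>" "\<sigma> v \<in> x' ` {..<k} \<longleftrightarrow> v \<in> x ` {..<k}"
      using mem_image[of v \<Omega>] mem_image[of v "x ` {..<k}"] by (simp_all only: img_Omega img_x)
    then show ?thesis
      by (simp only: psi_label_def)
  qed
  have vert: "\<sigma> v \<in> pverts B.\<Delta> \<longleftrightarrow> v \<in> pverts A.\<Delta>" for v
    using mem_image[of v ?W] by (simp only: img_W verts)
  have "rename_labelled \<sigma> (psi_labelled_digraph lab0 lab_hash lab_ast \<Omega> k \<Gamma> \<tau> x)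
      = psi_labelled_digraph lab0 lab_hash lab_ast \<Omega> k \<Gamma>' \<tau>' x'"
    by (rule rename_labelled_eqI[OF \<sigma>_bij])
      (simp_all only: psi_labelled_digraph_def Let_def labelled_digraph.simps digraph label vert arc snd_conv)
  with perm \<sigma>_Omega show ?thesis
    by blast
qed

section \<open>Equivariance and injectivity of \<open>\<psi>\<close>\<close>

text \<open>\<open>\<pi>\<close> is \<open>f\<close> followed by the inverse of \<open>f'\<close>,
  extended by the identity. It compares two indexings of the same set of digraphs.\<close>

lemma bij_betw_reindex:
  assumes "bij_betw f S A" and "bij_betw f' S A"
  obtains \<pi> where "\<pi> permutes S" and "\<And>i. i \<in> S \<Longrightarrow> f' (\<pi> i) = f i"
proof
  let ?\<pi> = "\<lambda>i. if i \<in> S then inv_into S f' (f i) else i"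
  have "bij_betw (inv_into S f' \<circ> f) S S"
    using assms(1) bij_betw_inv_into[OF assms(2)] by (rule bij_betw_trans)
  then have "bij_betw ?\<pi> S S"
    by (rule bij_betw_cong[THEN iffD1, rotated]) simp
  then show "?\<pi> permutes S"
    by (rule bij_imp_permutes) simp
  show "f' (?\<pi> i) = f i" if "i \<in> S" for i
    using that bij_betw_inv_into_right[OF assms(2)] bij_betwE[OF assms(1)] by simp
qed

text \<open>For \<open>n = card \<Omega>\<close> these are the index blocks of the parts
  \<open>V i\<close>, which have to exhaust the first \<open>k * n\<close> indices.\<close>

lemma UN_consecutive_blocks:
  fixes n :: nat
  shows "(\<Union>i<k. {i * n..<i * n + n}) = {..<k * n}"
proof (induction k)
  case (Suc k)
  then show ?case
    by (auto simp: lessThan_Suc)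
qed simp

lemma inj_rename_digraph:
  assumes "bij g"
  shows "inj (rename_digraph g)"
proof (rule inj_on_inverseI)
  fix \<Gamma>
  show "rename_digraph (inv_into UNIV g) (rename_digraph g \<Gamma>) = \<Gamma>"
    using assms by (simp add: bij_is_inj flip: rename_digraph_comp)
qed

lemma card_rename_digraph_image:
  assumes "bij g"
  shows "card (rename_digraph g ` A) = card A"
  by (rule card_image[OF inj_on_subset[OF inj_rename_digraph[OF assms]]]) simp

lemma rename_digraphs_on:
  assumes g: "g permutes \<Omega>" and "A \<subseteq> digraphs_on \<Omega>"
  shows "rename_digraph g ` A \<subseteq> digraphs_on \<Omega>"
proof -
  have "rename_digraph g \<Delta> \<in> digraphs_on \<Omega>" if "\<Delta> \<in> digraphs_on \<Omega>" for \<Delta>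
    using that permutes_image[OF g] permutes_in_image[OF g]
    by (auto simp: digraphs_on_def rename_digraph_def pair_wf_digraph_def)
  then show ?thesis
    using assms(2) by blast
qed

section \<open>Choices of new vertices and well-definedness of \<psi>\<close>

locale psi_setting =
  fixes \<Lambda> \<Omega> :: "'a::wellorder set" and lab0 lab_hash lab_ast :: 'l
  assumes fin_Omega: "finite \<Omega>" and inf_Lambda: "infinite \<Lambda>" and Omega_subset: "\<Omega> \<subseteq> \<Lambda>"
    and labels: "distinct [lab0, lab_hash, lab_ast]"
begin

abbreviation new_vertex :: "nat \<Rightarrow> 'a" where
  "new_vertex \<equiv> enumerate (\<Lambda> - \<Omega>)"

text \<open>One block of \<open>card \<Omega>\<close> vertices per digraph, then the set X. Only the
  size of \<open>A\<close> enters, so \<open>A\<close> and its renamings have the same new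
  vertices.\<close>

abbreviation new_vertices :: "'a pair_pre_digraph set \<Rightarrow> 'a set" where
  "new_vertices A \<equiv> new_vertex ` {..<card A * card \<Omega> + card A}"

abbreviation \<psi> :: "'a pair_pre_digraph set \<Rightarrow> ('a, 'l) labelled_digraph set" where
  "\<psi> \<equiv> psi lab0 lab_hash lab_ast \<Lambda> \<Omega>"

abbreviation \<Psi> :: "'a pair_pre_digraph set \<Rightarrow> (nat \<Rightarrow> 'a pair_pre_digraph) \<Rightarrow> (nat \<Rightarrow> 'a \<Rightarrow> 'a)
    \<Rightarrow> (nat \<Rightarrow> 'a) \<Rightarrow> ('a, 'l) labelled_digraph" where
  "\<Psi> A \<Gamma> \<tau> x \<equiv> psi_labelled_digraph lab0 lab_hash lab_ast \<Omega> (card A) \<Gamma> \<tau> x"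

lemma infinite_new: "infinite (\<Lambda> - \<Omega>)"
  using inf_Lambda fin_Omega by simp

lemma new_vertex_eq_iff [simp]: "new_vertex i = new_vertex j \<longleftrightarrow> i = j"
  using inj_enumerate[OF infinite_new] by (auto dest: injD)

lemma new_vertex_mem: "new_vertex i \<in> \<Lambda> - \<Omega>"
  by (rule enumerate_in_set[OF infinite_new])

lemma new_vertices_disjoint: "\<Omega> \<inter> new_vertex ` I = {}"
  using new_vertex_mem by blast

text \<open>Copies take the new vertices with index below \<open>?m\<close>, the \<open>x i\<close>
  those from \<open>?m\<close> on; injectivity of the enumeration separates the two, and
  disjointness of the \<open>V i\<close> separates the copies.\<close>

lemma psi_choice_layout:
  assumes choice: "psi_choice \<Lambda> \<Omega> A \<Gamma> V \<tau> x" and A: "A \<subseteq> digraphs_on \<Omega>"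
  shows "psi_layout \<Omega> (card A) \<Gamma> \<tau> x"
    and "pverts (psi_digraph \<Omega> (card A) \<Gamma> \<tau> x) = \<Omega> \<union> new_vertices A"
proof -
  let ?k = "card A" and ?m = "card A * card \<Omega>"
  have \<Gamma>: "bij_betw \<Gamma> {..<?k} A" and disj: "disjoint_family_on V {..<?k}"
    and V: "(\<Union>i<?k. V i) = new_vertex ` {..<?m}"
    and \<tau>: "\<And>i. i < ?k \<Longrightarrow> bij_betw (\<tau> i) \<Omega> (V i)"
    and x: "bij_betw x {..<?k} (new_vertex ` {?m..<?m + ?k})"
    using choice by (auto simp: psi_choice_def Let_def)
  have \<tau>_V: "\<tau> i \<alpha> \<in> V i" if "i < ?k" "\<alpha> \<in> \<Omega>" for i \<alpha>
    using \<tau>[OF that(1)] that(2) by (rule bij_betw_apply)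
  have \<tau>_new: "\<tau> i \<alpha> \<in> new_vertex ` {..<?m}" if "i < ?k" "\<alpha> \<in> \<Omega>" for i \<alpha>
    using \<tau>_V[OF that] that(1) V by blast
  have x_new: "x i \<in> new_vertex ` {?m..<?m + ?k}" if "i < ?k" for i
    using bij_betw_apply[OF x] that by simp
  show "psi_layout \<Omega> ?k \<Gamma> \<tau> x"
  proof
    fix i assume i: "i < ?k"
    then have "\<Gamma> i \<in> digraphs_on \<Omega>"
      using bij_betw_apply[OF \<Gamma>] A by blast
    then show "parcs (\<Gamma> i) \<subseteq> \<Omega> \<times> \<Omega>"
      by (auto simp: digraphs_on_def dest: pair_wf_digraph.in_arcsD1 pair_wf_digraph.in_arcsD2)
    show "x i \<notin> \<Omega>"
      using x_new[OF i] new_vertices_disjoint by blast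
    show "\<tau> i \<alpha> \<notin> \<Omega>" if "\<alpha> \<in> \<Omega>" for \<alpha>
      using \<tau>_new[OF i that] new_vertices_disjoint by blast
    fix j assume j: "j < ?k"
    show "i = j" if "x i = x j"
      using bij_betw_imp_inj_on[OF x] that i j by (simp add: inj_on_eq_iff)
    show "\<tau> i \<alpha> \<noteq> x j" if "\<alpha> \<in> \<Omega>" for \<alpha>
      using \<tau>_new[OF i that] x_new[OF j] by auto
    fix \<alpha> \<beta> assume \<alpha>: "\<alpha> \<in> \<Omega>" and \<beta>: "\<beta> \<in> \<Omega>" and eq: "\<tau> i \<alpha> = \<tau> j \<beta>"
    have "V i \<inter> V j \<noteq> {}"
      using \<tau>_V[OF i \<alpha>] \<tau>_V[OF j \<beta>] eq by auto
    then have "i = j"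
      using disj i j by (auto simp: disjoint_family_on_def)
    then show "i = j \<and> \<alpha> = \<beta>"
      using bij_betw_imp_inj_on[OF \<tau>[OF i]] \<alpha> \<beta> eq by (auto dest: inj_onD)
  qed
  have "(\<Union>i<?k. \<tau> i ` \<Omega>) = new_vertex ` {..<?m}"
    using \<tau> unfolding V[symmetric] by (intro SUP_cong) (auto simp: bij_betw_def)
  moreover have "x ` {..<?k} = new_vertex ` {?m..<?m + ?k}"
    using x by (simp add: bij_betw_def)
  moreover have "{..<?m + ?k} = {..<?m} \<union> {?m..<?m + ?k}"
    by auto
  ultimately show "pverts (psi_digraph \<Omega> ?k \<Gamma> \<tau> x) = \<Omega> \<union> new_vertices A"
    by (simp add: psi_digraph_def image_Un Un_assoc)
qed

text \<open>\<open>V i\<close> is the \<open>i\<close>-th block of \<open>?n\<close> consecutive new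
  vertices, matched with \<Omega> by a numbering \<open>h\<close>, and \<open>x\<close> runs through
  the \<open>?k\<close> vertices after the last block.\<close>

lemma psi_choice_exists:
  assumes "finite A"
  shows "\<exists>\<Gamma> V \<tau> x. psi_choice \<Lambda> \<Omega> A \<Gamma> V \<tau> x"
proof -
  let ?k = "card A" and ?n = "card \<Omega>" and ?m = "card A * card \<Omega>"
  obtain \<Gamma> where \<Gamma>: "bij_betw \<Gamma> {..<?k} A"
    using ex_bij_betw_nat_finite[OF assms] by (auto simp: atLeast0LessThan)
  obtain h where h: "bij_betw h \<Omega> {..<?n}"
    using ex_bij_betw_finite_nat[OF fin_Omega] by (auto simp: atLeast0LessThan)
  define V where "V i = new_vertex ` {i * ?n..<i * ?n + ?n}" for i
  define \<tau> where "\<tau> i \<alpha> = new_vertex (i * ?n + h \<alpha>)" for i \<alpha>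
  define x where "x i = new_vertex (?m + i)" for i
  have "{i * ?n..<i * ?n + ?n} \<inter> {j * ?n..<j * ?n + ?n} = {}" if "i \<noteq> j" for i j
  proof -
    \<comment> \<open>Integer division recovers the block from an index, so distinct blocks are
      disjoint.\<close>
    have "t div ?n = i" if "t \<in> {i * ?n..<i * ?n + ?n}" for t i
      using that by (intro div_nat_eqI) (simp_all add: mult.commute)
    with that show ?thesis by blast
  qed
  then have "disjoint_family_on V {..<?k}"
    unfolding disjoint_family_on_def V_def
    by (simp add: image_Int[symmetric] inj_enumerate[OF infinite_new])
  moreover have "(\<Union>i<?k. V i) = new_vertex ` {..<?m}"
    unfolding V_def UN_consecutive_blocks[symmetric] by (simp add: image_UN)
  moreover have "bij_betw (\<tau> i) \<Omega> (V i)" for i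
  proof -
    have "bij_betw ((+) (i * ?n)) {..<?n} {i * ?n..<i * ?n + ?n}"
      by (simp add: bij_betw_def lessThan_atLeast0 add.commute)
    moreover have "bij_betw new_vertex {i * ?n..<i * ?n + ?n} (V i)"
      by (simp add: bij_betw_def inj_on_def V_def)
    ultimately have "bij_betw (new_vertex \<circ> ((+) (i * ?n) \<circ> h)) \<Omega> (V i)"
      using h by (intro bij_betw_trans)
    then show ?thesis
      by (simp add: \<tau>_def[abs_def] comp_def)
  qed
  moreover have "bij_betw x {..<?k} (new_vertex ` {?m..<?m + ?k})"
  proof -
    have "{?m..<?m + ?k} = (+) ?m ` {..<?k}"
      by (simp add: lessThan_atLeast0 add.commute)
    then show ?thesis
      by (simp add: bij_betw_def inj_on_def x_def image_image)
  qed
  ultimately have "psi_choice \<Lambda> \<Omega> A \<Gamma> V \<tau> x"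
    using \<Gamma> by (simp add: psi_choice_def Let_def)
  then show ?thesis by blast
qed

text \<open>For \<open>g = id\<close> this is independence of the choices, for general
  \<open>g\<close> equivariance. The isomorphism \<open>\<sigma>\<close> extending \<open>g\<close>
  differs from \<open>g\<close> only by a permutation of the new vertices.\<close>

lemma psi_choice_orbit:
  assumes A: "A \<subseteq> digraphs_on \<Omega>" and g: "g permutes \<Omega>"
    and choice: "psi_choice \<Lambda> \<Omega> A \<Gamma> V \<tau> x"
    and choice': "psi_choice \<Lambda> \<Omega> (rename_digraph g ` A) \<Gamma>' V' \<tau>' x'"
  shows "labelled_orbit (new_vertices A) (\<Psi> (rename_digraph g ` A) \<Gamma>' \<tau>' x')
    = labelled_orbit (new_vertices A) (rename_labelled g (\<Psi> A \<Gamma> \<tau> x))"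
proof -
  let ?k = "card A" and ?N = "new_vertices A"
  have inj: "inj_on (rename_digraph g) A"
    using inj_rename_digraph[OF permutes_bij[OF g]] by (rule inj_on_subset) simp
  have card: "card (rename_digraph g ` A) = ?k"
    by (rule card_rename_digraph_image[OF permutes_bij[OF g]])
  note layout = psi_choice_layout[OF choice A]
  note layout' = psi_choice_layout[OF choice' rename_digraphs_on[OF g A], unfolded card]
  have "bij_betw \<Gamma> {..<?k} A"
    using choice by (simp add: psi_choice_def Let_def)
  then have bij: "bij_betw (rename_digraph g \<circ> \<Gamma>) {..<?k} (rename_digraph g ` A)"
    using inj by (intro bij_betw_trans[of _ _ A]) (simp_all add: bij_betw_def)
  have bij': "bij_betw \<Gamma>' {..<?k} (rename_digraph g ` A)"
    using choice' by (simp add: psi_choice_def Let_def card)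
  \<comment> \<open>\<open>\<Gamma>'\<close> and the renamed \<open>\<Gamma>\<close> index the same
    set, so they differ by a permutation of the indices.\<close>
  obtain \<pi> where \<pi>: "\<pi> permutes {..<?k}"
    and \<Gamma>': "\<And>i. i \<in> {..<?k} \<Longrightarrow> \<Gamma>' (\<pi> i) = (rename_digraph g \<circ> \<Gamma>) i"
    by (rule bij_betw_reindex[OF bij bij']) blast
  then have "parcs (\<Gamma>' (\<pi> i)) = map_prod g g ` parcs (\<Gamma> i)" if "i < ?k" for i
    using that by (simp add: rename_digraph_def)
  then obtain \<sigma> where \<sigma>: "\<sigma> permutes \<Omega> \<union> ?N" and \<sigma>_g: "\<And>\<alpha>. \<alpha> \<in> \<Omega> \<Longrightarrow> \<sigma> \<alpha> = g \<alpha>"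
    and rename: "rename_labelled \<sigma> (\<Psi> A \<Gamma> \<tau> x)
      = psi_labelled_digraph lab0 lab_hash lab_ast \<Omega> ?k \<Gamma>' \<tau>' x'"
    using psi_labelled_digraph_extend_renaming[OF layout(1) layout'(1) labels fin_Omega g \<pi>]
    unfolding layout(2) layout'(2) by blast
  \<comment> \<open>As \<open>\<sigma>\<close> agrees with \<open>g\<close> on \<Omega>, undoing
    \<open>g\<close> first leaves \<Omega> pointwise fixed, so \<open>?\<rho>\<close> lies in the
    group that defines the orbit.\<close>
  let ?g' = "inv_into UNIV g" and ?\<rho> = "\<sigma> \<circ> inv_into UNIV g"
  have g': "?g' permutes \<Omega>"
    using g by (rule permutes_inv)
  then have "?g' permutes \<Omega> \<union> ?N"
    by (rule permutes_subset) blast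
  then have \<rho>_all: "?\<rho> permutes \<Omega> \<union> ?N"
    using \<sigma> by (rule permutes_compose)
  have \<rho>_Omega: "?\<rho> v = v" if "v \<in> \<Omega>" for v
    using that \<sigma>_g permutes_in_image[OF g'] permutes_inverses[OF g] by simp
  have \<rho>: "?\<rho> permutes ?N"
  proof (rule permutes_superset[OF \<rho>_all])
    fix v assume "v \<in> \<Omega> \<union> ?N - ?N"
    then have "v \<in> \<Omega>" by blast
    then show "?\<rho> v = v" by (rule \<rho>_Omega)
  qed
  have "rename_labelled ?\<rho> (rename_labelled g (\<Psi> A \<Gamma> \<tau> x)) = rename_labelled (?\<rho> \<circ> g) (\<Psi> A \<Gamma> \<tau> x)"
    by (rule rename_labelled_comp[OF permutes_bij[OF \<rho>] permutes_bij[OF g], symmetric])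
  also have "?\<rho> \<circ> g = \<sigma>"
    using permutes_inv_o[OF g] by (simp add: comp_assoc)
  finally have "rename_labelled ?\<rho> (rename_labelled g (\<Psi> A \<Gamma> \<tau> x))
      = \<Psi> (rename_digraph g ` A) \<Gamma>' \<tau>' x'"
    by (simp only: rename card)
  then show ?thesis
    using labelled_orbit_rename[OF \<rho>] by metis
qed

text \<open>The orbit of a chosen labelled digraph is a witness for \<open>THE\<close>. It is
  unique: an extended graph containing any chosen labelled digraph is the orbit of that digraph, and
  all choices give the same orbit.\<close>

lemma psi_eq:
  assumes A: "A \<subseteq> digraphs_on \<Omega>" and choice: "psi_choice \<Lambda> \<Omega> A \<Gamma> V \<tau> x"
  shows "\<psi> A = labelled_orbit (new_vertices A) (\<Psi> A \<Gamma> \<tau> x)"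
    and "\<psi> A \<in> extended_graphs \<Lambda> \<Omega>"
proof -
  let ?N = "new_vertices A" and ?E = "labelled_orbit (new_vertices A) (\<Psi> A \<Gamma> \<tau> x)"
  have N: "(\<Omega> \<union> ?N) - \<Omega> = ?N"
    using new_vertices_disjoint by blast
  note layout = psi_choice_layout[OF choice A]
  have "\<Psi> A \<Gamma> \<tau> x \<in> labelled_digraphs_on (\<Omega> \<union> ?N)"
    using psi_layout.Psi_labelled_digraphs_on[OF layout(1) labels] unfolding layout(2) .
  then have "?E \<in> Group_Action.orbits (Sym ((\<Omega> \<union> ?N) - \<Omega>)) (labelled_digraphs_on (\<Omega> \<union> ?N)) rename_labelled"
    unfolding N Group_Action.orbits_def by blast
  moreover have "\<Omega> \<union> ?N \<in> {V. finite V \<and> \<Omega> \<subseteq> V \<and> V \<subseteq> \<Lambda>}"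
    using fin_Omega Omega_subset new_vertex_mem by auto
  ultimately have E: "?E \<in> extended_graphs \<Lambda> \<Omega>"
    unfolding extended_graphs_def by (rule UN_I[rotated])
  show eq: "\<psi> A = ?E"
    unfolding psi_def
  proof (rule the_equality)
    show "?E \<in> extended_graphs \<Lambda> \<Omega> \<and> (\<exists>\<Gamma> V \<tau> x. psi_choice \<Lambda> \<Omega> A \<Gamma> V \<tau> x \<and> \<Psi> A \<Gamma> \<tau> x \<in> ?E)"
      using E choice labelled_orbit_self by blast
  next
    fix E' assume "E' \<in> extended_graphs \<Lambda> \<Omega>
      \<and> (\<exists>\<Gamma> V \<tau> x. psi_choice \<Lambda> \<Omega> A \<Gamma> V \<tau> x \<and> \<Psi> A \<Gamma> \<tau> x \<in> E')"
    then obtain \<Gamma>' V' \<tau>' x' where "E' \<in> extended_graphs \<Lambda> \<Omega>"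
      and choice': "psi_choice \<Lambda> \<Omega> A \<Gamma>' V' \<tau>' x'" and mem: "\<Psi> A \<Gamma>' \<tau>' x' \<in> E'"
      by (elim conjE exE)
    then obtain W \<Delta> where \<Delta>: "\<Delta> \<in> labelled_digraphs_on W"
      and E': "E' = labelled_orbit (W - \<Omega>) \<Delta>"
      by (auto simp: extended_graphs_def Group_Action.orbits_def)
    obtain h where h: "h permutes W - \<Omega>" "\<Psi> A \<Gamma>' \<tau>' x' = rename_labelled h \<Delta>"
      using mem unfolding E' labelled_orbit_eq by blast
    note layout' = psi_choice_layout[OF choice' A]
    \<comment> \<open>The vertex set \<open>W\<close> behind \<open>E'\<close> is unknown; as
      \<open>h\<close> preserves it, it can be read off from the chosen digraph.\<close>
    have "h permutes W"
      using h(1) by (rule permutes_subset) blast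
    then have "pverts (digraph (rename_labelled h \<Delta>)) = W"
      using \<Delta> by (simp add: labelled_digraphs_on_def digraphs_on_def rename_labelled_def
          rename_digraph_def permutes_image)
    then have "W = \<Omega> \<union> ?N"
      using layout'(2) psi_layout.digraph_Psi[OF layout'(1) labels] by (simp flip: h(2))
    then have "E' = labelled_orbit ?N (\<Psi> A \<Gamma>' \<tau>' x')"
      using labelled_orbit_cong[OF mem[unfolded E']] N E' by simp
    also have "\<dots> = ?E"
    proof -
      have id: "rename_digraph id ` A = A"
        by simp
      show ?thesis
        using psi_choice_orbit[OF A permutes_id choice, unfolded id, OF choice'] by simp
    qed
    finally show "E' = ?E" .
  qed
  show "\<psi> A \<in> extended_graphs \<Lambda> \<Omega>"
    using E by (simp only: eq)
qed

section \<open>The action on the values of \<psi>\<close>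

text \<open>\<open>A\<close> and its renaming have the same size, so both values of \<psi> are
  orbits of the same group, and \<open>psi_choice_orbit\<close> compares them.\<close>

lemma psi_rename:
  assumes A: "A \<subseteq> digraphs_on \<Omega>" "finite A" and g: "g permutes \<Omega>"
  shows "rename_extended g (\<psi> A) = \<psi> (rename_digraph g ` A)"
proof -
  obtain \<Gamma> V \<tau> x where choice: "psi_choice \<Lambda> \<Omega> A \<Gamma> V \<tau> x"
    using psi_choice_exists[OF A(2)] by blast
  obtain \<Gamma>' V' \<tau>' x' where choice': "psi_choice \<Lambda> \<Omega> (rename_digraph g ` A) \<Gamma>' V' \<tau>' x'"
    using psi_choice_exists[of "rename_digraph g ` A"] A(2) by blast
  have card: "card (rename_digraph g ` A) = card A"
    by (rule card_rename_digraph_image[OF permutes_bij[OF g]])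
  show ?thesis
    using psi_choice_orbit[OF A(1) g choice choice']
    by (simp only: psi_eq(1)[OF A(1) choice] psi_eq(1)[OF rename_digraphs_on[OF g A(1)] choice'] card
        rename_extended_orbit[OF g new_vertices_disjoint])
qed

text \<open>The equation yields an isomorphism of chosen labelled digraphs that extends
  \<open>g\<close>, and it carries each component for \<open>A\<close> to one for \<open>B\<close>.
  Only an inclusion results, as the sizes of \<open>A\<close> and \<open>B\<close> are not
  compared.\<close>

lemma rename_psi_subset:
  assumes A: "A \<subseteq> digraphs_on \<Omega>" "finite A" and B: "B \<subseteq> digraphs_on \<Omega>" "finite B"
    and g: "g permutes \<Omega>" and eq: "rename_extended g (\<psi> A) = \<psi> B"
  shows "rename_digraph g ` A \<subseteq> B"
proof (rule image_subsetI)
  fix \<Delta> assume \<Delta>: "\<Delta> \<in> A"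
  obtain \<Gamma> V \<tau> x where choice: "psi_choice \<Lambda> \<Omega> A \<Gamma> V \<tau> x"
    using psi_choice_exists[OF A(2)] by blast
  obtain \<Gamma>' V' \<tau>' x' where choice': "psi_choice \<Lambda> \<Omega> B \<Gamma>' V' \<tau>' x'"
    using psi_choice_exists[OF B(2)] by blast
  let ?A = "\<Psi> A \<Gamma> \<tau> x" and ?B = "\<Psi> B \<Gamma>' \<tau>' x'"
  note layout = psi_choice_layout[OF choice A(1)]
  note layout' = psi_choice_layout[OF choice' B(1)]
  have "rename_labelled g ?A \<in> rename_extended g (\<psi> A)"
    unfolding rename_extended_def psi_eq(1)[OF A(1) choice] by (intro imageI labelled_orbit_self)
  then obtain \<rho> where \<rho>: "\<rho> permutes new_vertices B" "rename_labelled g ?A = rename_labelled \<rho> ?B"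
    unfolding eq psi_eq(1)[OF B(1) choice'] labelled_orbit_eq by blast
  \<comment> \<open>Undoing \<open>\<rho>\<close> after \<open>g\<close> gives an isomorphism onto
    \<open>?B\<close>; it still acts as \<open>g\<close> on \<Omega>, because \<open>\<rho>\<close>
    moves only new vertices.\<close>
  let ?\<rho>' = "inv_into UNIV \<rho>"
  have \<rho>': "?\<rho>' permutes new_vertices B"
    using \<rho>(1) by (rule permutes_inv)
  have "rename_labelled (?\<rho>' \<circ> g) ?A = rename_labelled ?\<rho>' (rename_labelled \<rho> ?B)"
    by (simp only: rename_labelled_comp[OF permutes_bij[OF \<rho>'] permutes_bij[OF g]] \<rho>(2))
  also have "\<dots> = ?B"
    unfolding rename_labelled_comp[OF permutes_bij[OF \<rho>'] permutes_bij[OF \<rho>(1)], symmetric]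
      permutes_inv_o(2)[OF \<rho>(1)] by (rule rename_labelled_id)
  finally have rename: "rename_labelled (?\<rho>' \<circ> g) ?A = ?B" .
  have bij: "bij (?\<rho>' \<circ> g)"
    using permutes_bij[OF g] permutes_bij[OF \<rho>'] by (rule bij_comp)
  have agree: "(?\<rho>' \<circ> g) \<alpha> = g \<alpha>" if "\<alpha> \<in> \<Omega>" for \<alpha>
  proof -
    have "g \<alpha> \<notin> new_vertices B"
      using that permutes_in_image[OF g] new_vertices_disjoint by blast
    then show ?thesis
      using permutes_not_in[OF \<rho>'] by simp
  qed
  have \<Gamma>: "bij_betw \<Gamma> {..<card A} A" and \<Gamma>': "bij_betw \<Gamma>' {..<card B} B"
    using choice choice' by (simp_all add: psi_choice_def Let_def)
  obtain i where i: "i < card A" "\<Delta> = \<Gamma> i"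
    using \<Delta> \<Gamma> by (auto simp: bij_betw_def)
  obtain j where j: "j < card B" "parcs (\<Gamma>' j) = map_prod g g ` parcs (\<Gamma> i)"
    using psi_labelled_digraph_rename_component[OF layout(1) layout'(1) labels g bij agree rename i(1)]
    by blast
  have mem: "\<Gamma>' j \<in> B"
    using \<Gamma>' j(1) by (auto simp: bij_betw_def)
  then have "pverts (\<Gamma>' j) = \<Omega>"
    using B(1) by (auto simp: digraphs_on_def)
  moreover have "pverts \<Delta> = \<Omega>"
    using A(1) \<Delta> by (auto simp: digraphs_on_def)
  ultimately have "rename_digraph g \<Delta> = \<Gamma>' j"
    using j(2) i(2) permutes_image[OF g] by (simp add: rename_digraph_def)
  with mem show "rename_digraph g \<Delta> \<in> B" by simp
qed

text \<open>One inclusion is \<open>rename_psi_subset\<close> for \<open>g\<close>. The other is the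
  same lemma for the identity, from \<open>B\<close> to the renamed \<open>A\<close>, whose values
  under \<psi> agree by equivariance.\<close>

lemma rename_psi_eq_iff:
  assumes A: "A \<subseteq> digraphs_on \<Omega>" "finite A" and B: "B \<subseteq> digraphs_on \<Omega>" "finite B"
    and g: "g permutes \<Omega>"
  shows "rename_extended g (\<psi> A) = \<psi> B \<longleftrightarrow> rename_digraph g ` A = B"
proof
  let ?gA = "rename_digraph g ` A"
  assume eq: "rename_extended g (\<psi> A) = \<psi> B"
  then have "\<psi> B = \<psi> ?gA"
    using psi_rename[OF A g] by simp
  moreover have "rename_extended id (\<psi> B) = \<psi> B"
    using psi_rename[OF B permutes_id] by simp
  ultimately have "rename_extended id (\<psi> B) = \<psi> ?gA"
    by simp
  with B rename_digraphs_on[OF g A(1)] finite_imageI[OF A(2)] permutes_id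
  have "rename_digraph id ` B \<subseteq> ?gA"
    by (rule rename_psi_subset)
  moreover have "?gA \<subseteq> B"
    using A B g eq by (rule rename_psi_subset)
  ultimately show "?gA = B"
    by simp
qed (simp only: psi_rename[OF A g])

section \<open>Perfect refiners\<close>

text \<open>By \<open>rename_psi_eq_iff\<close> the permutations taking \<open>A\<close> to
  \<open>B\<close> are those taking \<open>\<psi> A\<close> to \<open>\<psi> B\<close>. Appending
  these values as last entries adds exactly this condition to that of taking \<open>S\<close> to
  \<open>T\<close>.\<close>

lemma perfect_refiner_psi:
  assumes "A \<subseteq> digraphs_on \<Omega>" "finite A" and "B \<subseteq> digraphs_on \<Omega>" "finite B"
  shows "perfect_refiner \<Omega> rename_extended (extended_graphs \<Lambda> \<Omega>)
    (Transp \<Omega> (\<lambda>g A. rename_digraph g ` A) A B) (\<lambda>_. [\<psi> A]) (\<lambda>_. [\<psi> B])"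
proof -
  have Transp: "Transp \<Omega> (\<lambda>g A. rename_digraph g ` A) A B
      = {g. g permutes \<Omega> \<and> rename_extended g (\<psi> A) = \<psi> B}"
    using rename_psi_eq_iff[OF assms] by (auto simp: Transp_def)
  have "\<psi> A \<in> extended_graphs \<Lambda> \<Omega>" "\<psi> B \<in> extended_graphs \<Lambda> \<Omega>"
    using psi_eq(2) psi_choice_exists assms by metis+
  then show ?thesis
    unfolding perfect_refiner_def refiner_def Transp
    by (auto simp: Transp_def rename_stack_def)
qed

end

theorem mainTheorem3:
  fixes \<Lambda> \<Omega> :: "'a::wellorder set" and lab0 lab_hash lab_ast :: 'l
  assumes "finite \<Omega>" and "\<Omega> \<noteq> {}"
    and "infinite \<Lambda>" and "\<Omega> \<subseteq> \<Lambda>"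
    and "\<And>\<alpha> \<beta>. \<alpha> \<in> \<Omega> \<Longrightarrow> \<beta> \<in> \<Lambda> - \<Omega> \<Longrightarrow> \<alpha> < \<beta>"
    and "distinct [lab0, lab_hash, lab_ast]"
  shows
    "(\<forall>G\<in>two_closed_subgroups \<Omega>. \<forall>x\<in>carrier (Sym \<Omega>).
       conjugate \<Omega> x G \<in> two_closed_subgroups \<Omega>) \<and>
     (inj_on (orbital_graphs \<Omega>) (two_closed_subgroups \<Omega>)) \<and>
     (Sym_invariant_on \<Omega> (conjugate \<Omega>) (\<lambda>g A. rename_digraph g ` A)
       (two_closed_subgroups \<Omega>) (orbital_graphs \<Omega>)) \<and>
     (\<forall>G\<in>two_closed_subgroups \<Omega>. \<forall>H\<in>two_closed_subgroups \<Omega>.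
       {x \<in> carrier (Sym \<Omega>). conjugate \<Omega> x G = H} =
         Transp \<Omega> (\<lambda>g A. rename_digraph g ` A) (orbital_graphs \<Omega> G) (orbital_graphs \<Omega> H)) \<and>
     (\<forall>G\<in>two_closed_subgroups \<Omega>. \<forall>H\<in>two_closed_subgroups \<Omega>.
       perfect_refiner \<Omega> rename_extended (extended_graphs \<Lambda> \<Omega>)
         {x \<in> carrier (Sym \<Omega>). conjugate \<Omega> x G = H}
         (\<lambda>_. [psi lab0 lab_hash lab_ast \<Lambda> \<Omega> (orbital_graphs \<Omega> G)])
         (\<lambda>_. [psi lab0 lab_hash lab_ast \<Lambda> \<Omega> (orbital_graphs \<Omega> H)])) \<and>
     (\<forall>G\<in>two_closed_subgroups \<Omega>.
       perfect_refiner \<Omega> rename_extended (extended_graphs \<Lambda> \<Omega>)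
         (normalizer (Sym \<Omega>) G)
         (\<lambda>_. [psi lab0 lab_hash lab_ast \<Lambda> \<Omega> (orbital_graphs \<Omega> G)])
         (\<lambda>_. [psi lab0 lab_hash lab_ast \<Lambda> \<Omega> (orbital_graphs \<Omega> G)]))"
proof -
  interpret psi_setting \<Lambda> \<Omega> lab0 lab_hash lab_ast
    using assms by unfold_locales
  have subgroup: "subgroup G (Sym \<Omega>)" if "G \<in> two_closed_subgroups \<Omega>" for G
    using that by (simp add: two_closed_iff)
  have refiner: "perfect_refiner \<Omega> rename_extended (extended_graphs \<Lambda> \<Omega>)
      {x \<in> carrier (Sym \<Omega>). conjugate \<Omega> x G = H}
      (\<lambda>_. [psi lab0 lab_hash lab_ast \<Lambda> \<Omega> (orbital_graphs \<Omega> G)])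
      (\<lambda>_. [psi lab0 lab_hash lab_ast \<Lambda> \<Omega> (orbital_graphs \<Omega> H)])"
    if "G \<in> two_closed_subgroups \<Omega>" "H \<in> two_closed_subgroups \<Omega>" for G H
    \<comment> \<open>The conjugators become a transporter of finite sets of digraphs, to which the
      refiner built from \<psi> applies.\<close>
    unfolding conjugators_eq_Transp[OF that]
    using that subgroup orbital_graphs_digraphs_on finite_orbital_graphs[OF fin_Omega]
    by (intro perfect_refiner_psi) blast+
  show ?thesis
  proof (intro conjI ballI)
    show "conjugate \<Omega> x G \<in> two_closed_subgroups \<Omega>"
      if "G \<in> two_closed_subgroups \<Omega>" "x \<in> carrier (Sym \<Omega>)" for G x
      using that by (simp add: two_closed_conjugate)
    show "inj_on (orbital_graphs \<Omega>) (two_closed_subgroups \<Omega>)"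
      by (rule inj_on_orbital_graphs)
    show "Sym_invariant_on \<Omega> (conjugate \<Omega>) (\<lambda>g A. rename_digraph g ` A)
        (two_closed_subgroups \<Omega>) (orbital_graphs \<Omega>)"
      by (simp add: Sym_invariant_on_def orbital_graphs_conjugate)
  next
    fix G assume G: "G \<in> two_closed_subgroups \<Omega>"
    show "perfect_refiner \<Omega> rename_extended (extended_graphs \<Lambda> \<Omega>) (normalizer (Sym \<Omega>) G)
        (\<lambda>_. [psi lab0 lab_hash lab_ast \<Lambda> \<Omega> (orbital_graphs \<Omega> G)])
        (\<lambda>_. [psi lab0 lab_hash lab_ast \<Lambda> \<Omega> (orbital_graphs \<Omega> G)])"
      \<comment> \<open>The normaliser is the case \<open>H = G\<close>.\<close>
      unfolding normalizer_eq_conjugators[OF subgroup[OF G]] by (rule refiner[OF G G])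
  qed (rule conjugators_eq_Transp refiner; assumption)+
qed

end
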